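(* Let $\epsilon_{\boxplus}$ be the linear form on $\bigoplus_{k=0}^{\infty}\mathbb{C}[\mathcal{P}_k/\mathfrak{S}_k]$ which sends an orbit $\mathbf{p}$ on $\delta_{\mathbf{p}=\{\emptyset\}}$. Then $$\Big(\bigoplus_{k=0}^{\infty}\mathbb{C}[\mathcal{P}_k/\mathfrak{S}_k],\ \otimes,\ \{\emptyset\},\ \Delta_{\boxplus},\ \epsilon_{\boxplus}\Big)$$ (with product $\otimes$, unit $\{\emptyset\}$, coproduct $\Delta_{\boxplus}$ and counit $\epsilon_{\boxplus}$) is a graded connected Hopf algebra.
   Context: $\mathcal{P}_k$ is the set of partitions of $\{1,\dots,k\}\cup\{1',\dots,k'\}$, with $\mathcal{P}_0=\{\emptyset\}$. $\mathfrak{S}_k$ acts on $\mathcal{P}_k$ by simultaneously permuting the labels $1,\dots,k$ and $1',\dots,k'$ (conjugation $p\mapsto\sigma\circ p\circ\sigma^{-1}$); $\mathcal{P}_k/\mathfrak{S}_k$ is the set of orbits, and $[p]$ or $\mathbf{p}$ denotes the orbit of $p$. $\mathbb{C}[\mathcal{P}_k/\mathfrak{S}_k]$ is the complex vector space with basis $\mathcal{P}_k/\mathfrak{S}_k$; it is the component of degree $k$. For $p\in\mathcal{P}_k$, $q\in\mathcal{P}_l$, $p\otimes q\in\mathcal{P}_{k+l}$ is obtained by placing $q$ to the right of $p$ (labels $i,i'$ of $q$ become $k+i,(k+i)'$). The product on $\bigoplus_k\mathbb{C}[\mathcal{P}_k/\mathfrak{S}_k]$ is given by $[p]\otimes[q]=[p\otimes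 q]$, extended bilinearly; it does not depend on the representatives. With $\mathrm{id}_k=\{\{i,i'\}:1\le i\le k\}$, a partition $p\in\mathcal{P}_k$ is irreducible if $p\vee\mathrm{id}_k$ (the finest partition coarser than $p$ and $\mathrm{id}_k$) has exactly one block; $\emptyset$ is not irreducible. Every orbit has a representative of the form $p_1\otimes\cdots\otimes p_r$ with $p_1,\dots,p_r$ irreducible ($r=0$ for $\emptyset$). For such a representative, $$\Delta_{\boxplus}([p_1\otimes\cdots\otimes p_r])=\sum_{I\subset\{1,\dots,r\}}\Big[\bigotimes_{i\in I}p_i\Big]\otimes\Big[\bigotimes_{i\notin I}p_i\Big]\in\Big(\bigoplus_{k}\mathbb{C}[\mathcal{P}_k/\mathfrak{S}_k]\Big)\otimes\Big(\bigoplus_{k}\mathbb{C}[\mathcal{P}_k/\mathfrak{S}_k]\Big),$$ extended linearly (the empty product being $\emptyset$). Connected means that the degree $0$ component is one-dimensional. *)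

theory Defs
  imports Complex_Main "HOL-Library.Poly_Mapping" "HOL-Library.Disjoint_Sets"
    "HOL-Combinatorics.Permutations"
begin

section \<open>Free vector spaces and their tensor products\<close>

text \<open>
  The vector space over \<open>'k\<close> with basis the type \<open>'b\<close> is \<open>'b \<Rightarrow>\<^sub>0 'k\<close>.
  The library equips this type with addition but not with scalar multiplication.
\<close>

definition scale :: "'k::field \<Rightarrow> ('b \<Rightarrow>\<^sub>0 'k) \<Rightarrow> 'b \<Rightarrow>\<^sub>0 'k"
  where "scale c x = Poly_Mapping.map ((*) c) x"

lemma lookup_scale [simp]: "Poly_Mapping.lookup (scale c x) b = c * Poly_Mapping.lookup x b"
  unfolding scale_def by (simp add: Poly_Mapping.map.rep_eq when_def)

global_interpretation free: vector_space "scale :: 'k::field \<Rightarrow> ('b \<Rightarrow>\<^sub>0 'k) \<Rightarrow> 'b \<Rightarrow>\<^sub>0 'k"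
  by unfold_locales (auto intro!: poly_mapping_eqI simp: lookup_add algebra_simps)

definition basis :: "'b \<Rightarrow> 'b \<Rightarrow>\<^sub>0 'k::field"
  where "basis b = Poly_Mapping.single b 1"

text \<open>Linear extension of a map on the basis, into a vector space with scalar multiplication \<open>s\<close>.\<close>

definition lin_ext :: "('k::field \<Rightarrow> 'v \<Rightarrow> 'v) \<Rightarrow> ('b \<Rightarrow> 'v) \<Rightarrow> ('b \<Rightarrow>\<^sub>0 'k) \<Rightarrow> 'v::ab_group_add"
  where "lin_ext s \<phi> x = (\<Sum>b\<in>Poly_Mapping.keys x. s (Poly_Mapping.lookup x b) (\<phi> b))"

text \<open>
  The tensor product of the spaces with bases \<open>'a\<close> and \<open>'b\<close> is the space with basis \<open>'a \<times> 'b\<close>.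
  Lemma \<open>tensor_universal\<close> below is the universal property.
\<close>

definition tensor :: "('a \<Rightarrow>\<^sub>0 'k::field) \<Rightarrow> ('b \<Rightarrow>\<^sub>0 'k) \<Rightarrow> ('a \<times> 'b) \<Rightarrow>\<^sub>0 'k"
  where "tensor x y = (\<Sum>a\<in>Poly_Mapping.keys x. \<Sum>b\<in>Poly_Mapping.keys y.
    scale (Poly_Mapping.lookup x a * Poly_Mapping.lookup y b) (basis (a, b)))"

lemma lookup_basis: "Poly_Mapping.lookup (basis b) c = (if b = c then 1 else 0)"
  by (simp add: basis_def lookup_single when_def)

lemma lookup_tensor:
  "Poly_Mapping.lookup (tensor x y) (a, b) = Poly_Mapping.lookup x a * Poly_Mapping.lookup y b"
proof -
  have "Poly_Mapping.lookup (tensor x y) (a, b) =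
     (\<Sum>a'\<in>Poly_Mapping.keys x. \<Sum>b'\<in>Poly_Mapping.keys y.
        if b' = b then (if a' = a then Poly_Mapping.lookup x a' * Poly_Mapping.lookup y b' else 0) else 0)"
    unfolding tensor_def lookup_sum by (intro sum.cong refl) (auto simp: lookup_basis)
  also have "\<dots> = (\<Sum>a'\<in>Poly_Mapping.keys x.
        if a' = a then Poly_Mapping.lookup x a' * Poly_Mapping.lookup y b else 0)"
    by (intro sum.cong refl) (auto simp: sum.delta in_keys_iff)
  also have "\<dots> = Poly_Mapping.lookup x a * Poly_Mapping.lookup y b"
    by (auto simp: sum.delta in_keys_iff)
  finally show ?thesis .
qed

lemma tensor_basis: "tensor (basis a) (basis b) = basis (a, b)"
proof (rule poly_mapping_eqI)
  fix k :: "'a \<times> 'b"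
  show "Poly_Mapping.lookup (tensor (basis a) (basis b)) k = Poly_Mapping.lookup (basis (a, b)) k"
    by (cases k) (simp add: lookup_tensor lookup_basis)
qed

lemma lin_ext_superset:
  assumes "vector_space s" "finite B" "Poly_Mapping.keys x \<subseteq> B"
  shows "lin_ext s \<phi> x = (\<Sum>b\<in>B. s (Poly_Mapping.lookup x b) (\<phi> b))"
proof -
  interpret vector_space s by fact
  show ?thesis unfolding lin_ext_def
    using assms(2,3) by (intro sum.mono_neutral_left) (auto simp: in_keys_iff)
qed

lemma lin_ext_basis:
  assumes "vector_space s"
  shows "lin_ext s \<phi> (basis b) = \<phi> b"
proof -
  interpret vector_space s by fact
  show ?thesis by (simp add: lin_ext_def basis_def)
qed

lemma linear_lin_ext:
  fixes s :: "'k::field \<Rightarrow> 'v::ab_group_add \<Rightarrow> 'v" and \<phi> :: "'b \<Rightarrow> 'v"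
  assumes "vector_space s"
  shows "Vector_Spaces.linear scale s (lin_ext s \<phi>)"
proof -
  interpret vector_space s by fact
  show ?thesis
  proof unfold_locales
    fix x y :: "'b \<Rightarrow>\<^sub>0 'k" and c :: 'k
    let ?B = "Poly_Mapping.keys x \<union> Poly_Mapping.keys y"
    have "Poly_Mapping.keys (x + y) \<subseteq> ?B" by (rule Poly_Mapping.keys_add)
    then show "lin_ext s \<phi> (x + y) = lin_ext s \<phi> x + lin_ext s \<phi> y"
      by (simp add: lin_ext_superset[OF assms, where B = ?B] lookup_add scale_left_distrib
          sum.distrib)
    have "Poly_Mapping.keys (scale c x) \<subseteq> Poly_Mapping.keys x" by (auto simp: in_keys_iff)
    then show "lin_ext s \<phi> (scale c x) = s c (lin_ext s \<phi> x)"
      by (simp add: lin_ext_superset[OF assms, where B = "Poly_Mapping.keys x"] scale_sum_right)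
  qed
qed

lemma free_expand: "x = (\<Sum>b\<in>Poly_Mapping.keys x. scale (Poly_Mapping.lookup x b) (basis b))"
  by (rule poly_mapping_eqI) (auto simp: lookup_sum lookup_basis if_distrib sum.delta in_keys_iff
      cong: if_cong)

lemma linear_eq_lin_ext:
  assumes "Vector_Spaces.linear scale s F"
  shows "F = lin_ext s (\<lambda>b. F (basis b))"
proof
  fix x
  interpret Vector_Spaces.linear scale s F by fact
  show "F x = lin_ext s (\<lambda>b. F (basis b)) x"
    by (subst free_expand) (simp add: lin_ext_def sum scale)
qed

lemma tensor_universal:
  fixes s :: "'k::field \<Rightarrow> 'v::ab_group_add \<Rightarrow> 'v"
    and h :: "('a \<Rightarrow>\<^sub>0 'k) \<Rightarrow> ('b \<Rightarrow>\<^sub>0 'k) \<Rightarrow> 'v"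
  assumes "\<And>x. Vector_Spaces.linear scale s (h x)"
    and "\<And>y. Vector_Spaces.linear scale s (\<lambda>x. h x y)"
  shows "\<exists>!H. Vector_Spaces.linear scale s H \<and> (\<forall>x y. H (tensor x y) = h x y)"
proof -
  interpret a: Vector_Spaces.linear scale s "h x" for x by fact
  interpret b: Vector_Spaces.linear scale s "\<lambda>x. h x y" for y by fact
  have vs: "vector_space s" ..
  let ?H = "lin_ext s (\<lambda>(a, b). h (basis a) (basis b))"
  interpret H: Vector_Spaces.linear scale s ?H by (rule linear_lin_ext[OF vs])
  have "?H (tensor x y) = h x y" for x y
  proof -
    have "h x y = h (\<Sum>a\<in>Poly_Mapping.keys x. scale (Poly_Mapping.lookup x a) (basis a)) y"
      by (subst free_expand[of x]) simp
    also have "\<dots> = (\<Sum>a\<in>Poly_Mapping.keys x. s (Poly_Mapping.lookup x a) (h (basis a) y))"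
      by (simp add: b.sum b.scale)
    also have "\<dots> = (\<Sum>a\<in>Poly_Mapping.keys x. s (Poly_Mapping.lookup x a)
        (h (basis a) (\<Sum>b\<in>Poly_Mapping.keys y. scale (Poly_Mapping.lookup y b) (basis b))))"
      by (subst free_expand[of y]) simp
    also have "\<dots> = ?H (tensor x y)"
      by (simp add: tensor_def a.sum a.scale H.sum H.scale lin_ext_basis[OF vs]
          a.vs2.scale_sum_right)
    finally show ?thesis ..
  qed
  moreover have "G = ?H" if "Vector_Spaces.linear scale s G" "\<forall>x y. G (tensor x y) = h x y" for G
  proof -
    have "(\<lambda>c. G (basis c)) = (\<lambda>(a, b). h (basis a) (basis b))"
      by (auto simp: that(2)[rule_format, symmetric] tensor_basis)
    with linear_eq_lin_ext[OF that(1)] show ?thesis by (rule trans[OF _ arg_cong])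
  qed
  ultimately show ?thesis
    using H.linear_axioms by blast
qed

text \<open>The linear map \<open>F \<otimes> G\<close>.\<close>

definition tensor_map ::
  "(('a \<Rightarrow>\<^sub>0 'k::field) \<Rightarrow> ('c \<Rightarrow>\<^sub>0 'k)) \<Rightarrow> (('b \<Rightarrow>\<^sub>0 'k) \<Rightarrow> ('d \<Rightarrow>\<^sub>0 'k)) \<Rightarrow>
   (('a \<times> 'b) \<Rightarrow>\<^sub>0 'k) \<Rightarrow> (('c \<times> 'd) \<Rightarrow>\<^sub>0 'k)"
  where "tensor_map F G = lin_ext scale (\<lambda>(a, b). tensor (F (basis a)) (G (basis b)))"

definition assoc_iso :: "((('a \<times> 'b) \<times> 'c) \<Rightarrow>\<^sub>0 'k::field) \<Rightarrow> (('a \<times> ('b \<times> 'c)) \<Rightarrow>\<^sub>0 'k)"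
  where "assoc_iso = lin_ext scale (\<lambda>((a, b), c). basis (a, (b, c)))"

text \<open>\<open>u \<otimes> v \<otimes> w \<otimes> z \<mapsto> u \<otimes> w \<otimes> v \<otimes> z\<close>\<close>

definition middle_swap ::
  "((('a \<times> 'b) \<times> ('c \<times> 'd)) \<Rightarrow>\<^sub>0 'k::field) \<Rightarrow> ((('a \<times> 'c) \<times> ('b \<times> 'd)) \<Rightarrow>\<^sub>0 'k)"
  where "middle_swap = lin_ext scale (\<lambda>((a, b), (c, d)). basis ((a, c), (b, d)))"

text \<open>
  \<open>\<epsilon> \<otimes> id\<close> and \<open>id \<otimes> \<epsilon>\<close> for a linear form \<open>\<epsilon>\<close>, composed with the canonical isomorphisms from
  \<open>k \<otimes> V\<close> and \<open>V \<otimes> k\<close> to \<open>V\<close>.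
\<close>

definition contract_left ::
  "(('a \<Rightarrow>\<^sub>0 'k::field) \<Rightarrow> 'k) \<Rightarrow> (('a \<times> 'b) \<Rightarrow>\<^sub>0 'k) \<Rightarrow> ('b \<Rightarrow>\<^sub>0 'k)"
  where "contract_left e = lin_ext scale (\<lambda>(a, b). scale (e (basis a)) (basis b))"

definition contract_right ::
  "(('b \<Rightarrow>\<^sub>0 'k::field) \<Rightarrow> 'k) \<Rightarrow> (('a \<times> 'b) \<Rightarrow>\<^sub>0 'k) \<Rightarrow> ('a \<Rightarrow>\<^sub>0 'k)"
  where "contract_right e = lin_ext scale (\<lambda>(a, b). scale (e (basis b)) (basis a))"


section \<open>Graded connected Hopf algebras\<close>

locale unital_algebra =
  fixes \<mu> :: "(('b \<times> 'b) \<Rightarrow>\<^sub>0 'k::field) \<Rightarrow> ('b \<Rightarrow>\<^sub>0 'k)"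
    and \<eta> :: "'b \<Rightarrow>\<^sub>0 'k"
  assumes linear_mult: "Vector_Spaces.linear scale scale \<mu>"
    and mult_assoc: "\<mu> (tensor_map \<mu> id t) = \<mu> (tensor_map id \<mu> (assoc_iso t))"
    and mult_unit_left: "\<mu> (tensor \<eta> x) = x"
    and mult_unit_right: "\<mu> (tensor x \<eta>) = x"

locale counital_coalgebra =
  fixes \<Delta> :: "('b \<Rightarrow>\<^sub>0 'k::field) \<Rightarrow> (('b \<times> 'b) \<Rightarrow>\<^sub>0 'k)"
    and \<epsilon> :: "('b \<Rightarrow>\<^sub>0 'k) \<Rightarrow> 'k"
  assumes linear_comult: "Vector_Spaces.linear scale scale \<Delta>"
    and linear_counit: "Vector_Spaces.linear scale (*) \<epsilon>"
    and coassoc: "assoc_iso (tensor_map \<Delta> id (\<Delta> x)) = tensor_map id \<Delta> (\<Delta> x)"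
    and counit_left: "contract_left \<epsilon> (\<Delta> x) = x"
    and counit_right: "contract_right \<epsilon> (\<Delta> x) = x"

locale bialgebra = unital_algebra \<mu> \<eta> + counital_coalgebra \<Delta> \<epsilon>
  for \<mu> :: "(('b \<times> 'b) \<Rightarrow>\<^sub>0 'k::field) \<Rightarrow> ('b \<Rightarrow>\<^sub>0 'k)"
    and \<eta> :: "'b \<Rightarrow>\<^sub>0 'k"
    and \<Delta> :: "('b \<Rightarrow>\<^sub>0 'k) \<Rightarrow> (('b \<times> 'b) \<Rightarrow>\<^sub>0 'k)"
    and \<epsilon> :: "('b \<Rightarrow>\<^sub>0 'k) \<Rightarrow> 'k" +
  assumes comult_mult: "\<Delta> (\<mu> t) = tensor_map \<mu> \<mu> (middle_swap (tensor_map \<Delta> \<Delta> t))"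
    and comult_unit: "\<Delta> \<eta> = tensor \<eta> \<eta>"
    and counit_mult: "\<epsilon> (\<mu> (tensor x y)) = \<epsilon> x * \<epsilon> y"
    and counit_unit: "\<epsilon> \<eta> = 1"

locale vector_space_grading =
  fixes A :: "nat \<Rightarrow> ('b \<Rightarrow>\<^sub>0 'k::field) set"
  assumes subspace_component: "free.subspace (A n)"
    and direct_sum: "\<exists>!c. (\<forall>n. c n \<in> A n) \<and> finite {n. c n \<noteq> 0} \<and> x = (\<Sum>n | c n \<noteq> 0. c n)"

locale graded_bialgebra = bialgebra \<mu> \<eta> \<Delta> \<epsilon> + vector_space_grading A
  for A :: "nat \<Rightarrow> ('b \<Rightarrow>\<^sub>0 'k::field) set"
    and \<mu> :: "(('b \<times> 'b) \<Rightarrow>\<^sub>0 'k) \<Rightarrow> ('b \<Rightarrow>\<^sub>0 'k)"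
    and \<eta> :: "'b \<Rightarrow>\<^sub>0 'k"
    and \<Delta> :: "('b \<Rightarrow>\<^sub>0 'k) \<Rightarrow> (('b \<times> 'b) \<Rightarrow>\<^sub>0 'k)"
    and \<epsilon> :: "('b \<Rightarrow>\<^sub>0 'k) \<Rightarrow> 'k" +
  assumes graded_mult: "x \<in> A m \<Longrightarrow> y \<in> A n \<Longrightarrow> \<mu> (tensor x y) \<in> A (m + n)"
    and graded_unit: "\<eta> \<in> A 0"
    and graded_comult:
      "x \<in> A n \<Longrightarrow> \<Delta> x \<in> free.span {tensor y z | y z i j. y \<in> A i \<and> z \<in> A j \<and> i + j = n}"
    and graded_counit: "x \<in> A n \<Longrightarrow> n \<noteq> 0 \<Longrightarrow> \<epsilon> x = 0"

locale graded_hopf_algebra = graded_bialgebra A \<mu> \<eta> \<Delta> \<epsilon>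
  for A :: "nat \<Rightarrow> ('b \<Rightarrow>\<^sub>0 'k::field) set"
    and \<mu> :: "(('b \<times> 'b) \<Rightarrow>\<^sub>0 'k) \<Rightarrow> ('b \<Rightarrow>\<^sub>0 'k)"
    and \<eta> :: "'b \<Rightarrow>\<^sub>0 'k"
    and \<Delta> :: "('b \<Rightarrow>\<^sub>0 'k) \<Rightarrow> (('b \<times> 'b) \<Rightarrow>\<^sub>0 'k)"
    and \<epsilon> :: "('b \<Rightarrow>\<^sub>0 'k) \<Rightarrow> 'k" +
  assumes antipode: "\<exists>S. Vector_Spaces.linear scale scale S \<and>
      (\<forall>x. \<mu> (tensor_map S id (\<Delta> x)) = scale (\<epsilon> x) \<eta>) \<and>
      (\<forall>x. \<mu> (tensor_map id S (\<Delta> x)) = scale (\<epsilon> x) \<eta>) \<and>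
      (\<forall>n. S ` A n \<subseteq> A n)"

locale graded_connected_hopf_algebra = graded_hopf_algebra A \<mu> \<eta> \<Delta> \<epsilon>
  for A :: "nat \<Rightarrow> ('b \<Rightarrow>\<^sub>0 'k::field) set"
    and \<mu> :: "(('b \<times> 'b) \<Rightarrow>\<^sub>0 'k) \<Rightarrow> ('b \<Rightarrow>\<^sub>0 'k)"
    and \<eta> :: "'b \<Rightarrow>\<^sub>0 'k"
    and \<Delta> :: "('b \<Rightarrow>\<^sub>0 'k) \<Rightarrow> (('b \<times> 'b) \<Rightarrow>\<^sub>0 'k)"
    and \<epsilon> :: "('b \<Rightarrow>\<^sub>0 'k) \<Rightarrow> 'k" +
  assumes connected: "free.dim (A 0) = 1"


section \<open>Partitions of \<open>{1, \<dots>, k} \<union> {1', \<dots>, k'}\<close>\<close>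

datatype 'a label = Unprimed 'a | Primed 'a

type_synonym diagram = "nat label set set"

definition ground :: "nat \<Rightarrow> nat label set"
  where "ground k = Unprimed ` {1..k} \<union> Primed ` {1..k}"

definition partitions :: "nat \<Rightarrow> diagram set"
  where "partitions k = {p. partition_on (ground k) p}"

definition deg :: "diagram \<Rightarrow> nat"
  where "deg p = (THE k. p \<in> partitions k)"

definition relabel :: "(nat \<Rightarrow> nat) \<Rightarrow> diagram \<Rightarrow> diagram"
  where "relabel f p = (\<lambda>X. map_label f ` X) ` p"

lemma partitions_unique:
  assumes "p \<in> partitions k" "p \<in> partitions l"
  shows "k = l"
proof -
  have "card (ground n) = 2 * n" for n
    unfolding ground_def by (subst card_Un_disjoint) (auto simp: card_image inj_on_def)
  moreover have "ground k = ground l"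
    using assms by (auto simp: partitions_def partition_on_def)
  ultimately show ?thesis by (metis mult_left_cancel zero_neq_numeral)
qed

lemma deg_eq: "p \<in> partitions k \<Longrightarrow> deg p = k"
  unfolding deg_def using partitions_unique by blast

definition juxtapose :: "diagram \<Rightarrow> diagram \<Rightarrow> diagram"  (infixr "\<otimes>\<^sub>P" 70)
  where "p \<otimes>\<^sub>P q = p \<union> relabel (\<lambda>i. deg p + i) q"

definition juxtapose_list :: "diagram list \<Rightarrow> diagram"
  where "juxtapose_list ps = foldr (\<otimes>\<^sub>P) ps {}"

definition id_partition :: "nat \<Rightarrow> diagram"
  where "id_partition k = (\<lambda>i. {Unprimed i, Primed i}) ` {1..k}"

text \<open>\<open>p \<or> q\<close>: the finest partition of \<open>A\<close> coarser than both \<open>p\<close> and \<open>q\<close>.\<close>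

definition partition_join :: "'a set \<Rightarrow> 'a set set \<Rightarrow> 'a set set \<Rightarrow> 'a set set"
  where "partition_join A p q = (THE r. refines A p r \<and> refines A q r \<and>
    (\<forall>s. refines A p s \<and> refines A q s \<longrightarrow> refines A r s))"

lemma partition_join:
  assumes p: "partition_on A p" and q: "partition_on A q"
  shows "refines A p (partition_join A p q)"
    and "refines A q (partition_join A p q)"
    and "refines A p s \<Longrightarrow> refines A q s \<Longrightarrow> refines A (partition_join A p q) s"
proof -
  define E where "E P = {(x, y). \<exists>X\<in>P. x \<in> X \<and> y \<in> X}" for P :: "'a set set"
  have E: "equiv A (E P)" if "partition_on A P" for P
    using equiv_partition_on[OF that] by (simp add: E_def)
  define T where "T = (E p \<union> E q)\<^sup>+"
  have sub: "E p \<union> E q \<subseteq> A \<times> A" using E[OF p] E[OF q] by (auto simp: equiv_def)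
  have T: "equiv A T"
  proof (rule equivI)
    show "T \<subseteq> A \<times> A" unfolding T_def using sub by (rule trancl_subset_Sigma)
    show "refl_on A T" using E[OF p] by (auto simp: T_def equiv_def refl_on_def)
    have "sym (E p \<union> E q)" using E[OF p] E[OF q] by (auto simp: equiv_def intro: sym_Un)
    then show "sym T" unfolding T_def by (rule sym_trancl)
    show "trans T" unfolding T_def by (rule trans_trancl)
  qed
  have part: "partition_on A (A // T)" by (rule partition_on_quotient[OF T])
  have ref: "refines A P (A // T)" if P: "partition_on A P" "E P \<subseteq> T" for P
    unfolding refines_def
  proof (intro conjI ballI P(1) part)
    fix X assume X: "X \<in> P"
    then obtain x where x: "x \<in> X" using partition_onD3[OF P(1)] by (metis ex_in_conv)
    then have "X \<subseteq> T `` {x}" using X P(2) by (auto simp: E_def)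
    moreover have "x \<in> A" using x X P(1) by (auto simp: partition_on_def)
    ultimately show "\<exists>Y\<in>A // T. X \<subseteq> Y" by (auto simp: quotient_def)
  qed
  have least: "refines A (A // T) s" if s: "refines A p s" "refines A q s" for s
    unfolding refines_def
  proof (intro conjI ballI part)
    show S: "partition_on A s" using s by (simp add: refines_def)
    have "E P \<subseteq> E s" if "refines A P s" for P
      using that unfolding refines_def E_def by (auto dest!: bspec)
    then have "E p \<union> E q \<subseteq> E s" using s by blast
    then have "T \<subseteq> (E s)\<^sup>+" unfolding T_def by (auto intro: trancl_mono)
    also have "(E s)\<^sup>+ = E s" using E[OF S] by (intro trancl_id) (auto simp: equiv_def)
    finally have TS: "T \<subseteq> E s" .
    fix X assume "X \<in> A // T"
    then obtain x where x: "x \<in> A" "X = T `` {x}" by (auto elim: quotientE)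
    then obtain Y where Y: "Y \<in> s" "x \<in> Y" using S by (auto simp: partition_on_def)
    have "Y' = Y" if "Y' \<in> s" "x \<in> Y'" for Y'
      using that Y S by (auto simp: partition_on_def disjoint_def)
    then have "X \<subseteq> Y" using x TS by (auto simp: E_def)
    then show "\<exists>Y\<in>s. X \<subseteq> Y" using Y by blast
  qed
  have pT: "refines A p (A // T)" and qT: "refines A q (A // T)"
    by (rule ref[OF p], force simp: T_def) (rule ref[OF q], force simp: T_def)
  have "partition_join A p q = A // T"
    unfolding partition_join_def
    using pT qT least by (intro the_equality) (blast, metis refines_asym)
  then show "refines A p (partition_join A p q)" "refines A q (partition_join A p q)"
    "refines A p s \<Longrightarrow> refines A q s \<Longrightarrow> refines A (partition_join A p q) s"
    using pT qT least by auto
qed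

definition irreducible_diagram :: "diagram \<Rightarrow> bool"
  where "irreducible_diagram p \<longleftrightarrow>
    (\<exists>k. p \<in> partitions k \<and> card (partition_join (ground k) p (id_partition k)) = 1)"


section \<open>Orbits under simultaneous permutation of the labels\<close>

definition orbit_set :: "nat \<Rightarrow> diagram \<Rightarrow> diagram set"
  where "orbit_set k p = {relabel \<sigma> p | \<sigma>. \<sigma> permutes {1..k}}"

text \<open>
  The disjoint union of the sets \<open>\<P>\<^sub>k / \<SS>\<^sub>k\<close>. No index \<open>k\<close> has to be stored, since the
  \<open>partitions k\<close> are pairwise disjoint.
\<close>

typedef diagram_orbit = "{orbit_set k p | k p. p \<in> partitions k}"
  by (auto simp: partitions_def intro!: exI[of _ "{ground 0}"] exI[of _ 0] exI[of _ "{}"])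
    (simp add: ground_def partition_on_def)

definition orb :: "diagram \<Rightarrow> diagram_orbit"
  where "orb p = Abs_diagram_orbit (orbit_set (deg p) p)"

lemma relabel_comp: "relabel f (relabel g p) = relabel (f \<circ> g) p"
  by (simp add: relabel_def image_image label.map_comp)

lemma relabel_cong:
  assumes "p \<in> partitions k" "\<And>i. i \<in> {1..k} \<Longrightarrow> f i = g i"
  shows "relabel f p = relabel g p"
proof -
  have "map_label f x = map_label g x" if "X \<in> p" "x \<in> X" for x X
  proof -
    have "x \<in> ground k" using assms(1) that by (auto simp: partitions_def partition_on_def)
    then show ?thesis using assms(2) by (auto simp: ground_def)
  qed
  then show ?thesis unfolding relabel_def by (intro image_cong refl) auto
qed

lemma relabel_partition_on:
  assumes "p \<in> partitions k" "inj f"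
  shows "partition_on (map_label f ` ground k) (relabel f p)"
proof -
  have "inj_on (map_label f) (ground k)"
    using assms(2) by (auto intro!: inj_on_subset[OF label.inj_map])
  moreover have "relabel f p - {{}} = relabel f p"
    using assms(1) by (auto simp: partitions_def relabel_def partition_on_def)
  ultimately show ?thesis
    using assms(1) partition_on_inj_image[of "ground k" p "map_label f"]
    by (simp add: partitions_def relabel_def)
qed

lemma map_label_ground:
  "map_label f ` ground k = Unprimed ` (f ` {1..k}) \<union> Primed ` (f ` {1..k})"
  by (simp add: ground_def image_Un image_image)

lemma relabel_partitions:
  assumes "p \<in> partitions k" "\<sigma> permutes {1..k}"
  shows "relabel \<sigma> p \<in> partitions k"
proof -
  have "map_label \<sigma> ` ground k = ground k"
    unfolding map_label_ground permutes_image[OF assms(2)] by (simp add: ground_def)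
  then show ?thesis
    using relabel_partition_on[OF assms(1) permutes_inj[OF assms(2)]] by (simp add: partitions_def)
qed

lemma juxtapose_partitions:
  assumes "p \<in> partitions k" "q \<in> partitions l"
  shows "p \<otimes>\<^sub>P q \<in> partitions (k + l)"
proof -
  let ?G = "map_label ((+) k) ` ground l"
  have "(+) k ` {1..l} = {k + 1..k + l}" by simp
  then have G: "?G = Unprimed ` {k + 1..k + l} \<union> Primed ` {k + 1..k + l}"
    unfolding map_label_ground by (rule arg_cong)
  have "partition_on ?G (relabel ((+) k) q)"
    by (rule relabel_partition_on[OF assms(2)]) simp
  moreover have "ground k \<inter> ?G = {}" unfolding G by (auto simp: ground_def)
  moreover have "ground k \<union> ?G = ground (k + l)"
  proof -
    have *: "{1..k + l} = {1..k} \<union> {k + 1..k + l}" by auto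
    show ?thesis unfolding G unfolding ground_def * image_Un by blast
  qed
  ultimately show ?thesis
    using assms(1) disjoint_union[of p "relabel ((+) k) q"]
    by (auto simp: partitions_def partition_on_def juxtapose_def deg_eq[OF assms(1)])
qed

lemma orb_eqD:
  assumes "p \<in> partitions k" "p' \<in> partitions k'" "orb p = orb p'"
  shows "k' = k" "\<exists>\<sigma>. \<sigma> permutes {1..k} \<and> p' = relabel \<sigma> p"
proof -
  have "orbit_set k p = orbit_set k' p'"
    using assms Abs_diagram_orbit_inject[of "orbit_set k p" "orbit_set k' p'"]
    by (auto simp: orb_def deg_eq)
  moreover have "p' \<in> orbit_set k' p'"
    unfolding orbit_set_def mem_Collect_eq
    by (rule exI[of _ id]) (simp add: relabel_def label.map_id0 permutes_id)
  ultimately have "p' \<in> orbit_set k p" by simp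
  then show *: "\<exists>\<sigma>. \<sigma> permutes {1..k} \<and> p' = relabel \<sigma> p"
    by (auto simp: orbit_set_def)
  then show "k' = k"
    using relabel_partitions[OF assms(1)] assms(2) partitions_unique by blast
qed

lemma orb_relabel:
  assumes "p \<in> partitions k" "\<sigma> permutes {1..k}"
  shows "orb (relabel \<sigma> p) = orb p"
proof -
  have "orbit_set k (relabel \<sigma> p) = orbit_set k p"
  proof (intro equalityI subsetI)
    fix r assume "r \<in> orbit_set k (relabel \<sigma> p)"
    then obtain \<tau> where "\<tau> permutes {1..k}" "r = relabel (\<tau> \<circ> \<sigma>) p"
      by (auto simp: orbit_set_def relabel_comp)
    then show "r \<in> orbit_set k p"
      using permutes_compose[OF assms(2)] by (auto simp: orbit_set_def)
  next
    fix r assume "r \<in> orbit_set k p"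
    then obtain \<tau> where \<tau>: "\<tau> permutes {1..k}" "r = relabel \<tau> p"
      by (auto simp: orbit_set_def)
    then have "r = relabel (\<tau> \<circ> inv \<sigma>) (relabel \<sigma> p)"
      by (simp add: relabel_comp comp_assoc permutes_inv_o[OF assms(2)])
    then show "r \<in> orbit_set k (relabel \<sigma> p)"
      using permutes_compose[OF permutes_inv[OF assms(2)] \<tau>(1)] by (auto simp: orbit_set_def)
  qed
  then show ?thesis
    by (simp add: orb_def deg_eq[OF assms(1)] deg_eq[OF relabel_partitions[OF assms]])
qed

definition orbits :: "nat \<Rightarrow> diagram_orbit set"
  where "orbits k = orb ` partitions k"

definition orbit_mult :: "diagram_orbit \<Rightarrow> diagram_orbit \<Rightarrow> diagram_orbit"
  where "orbit_mult P Q = (THE R. \<exists>k l. \<exists>p\<in>partitions k. \<exists>q\<in>partitions l.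
    P = orb p \<and> Q = orb q \<and> R = orb (p \<otimes>\<^sub>P q))"

lemma orb_juxtapose_cong:
  assumes p: "p \<in> partitions k" and q: "q \<in> partitions l"
    and \<sigma>: "\<sigma> permutes {1..k}" and \<tau>: "\<tau> permutes {1..l}"
  shows "orb (relabel \<sigma> p \<otimes>\<^sub>P relabel \<tau> q) = orb (p \<otimes>\<^sub>P q)"
proof -
  define \<rho> where "\<rho> i = (if i \<le> k then \<sigma> i else k + \<tau> (i - k))" for i
  have \<sigma>_le: "\<sigma> i \<le> k \<longleftrightarrow> i \<le> k" for i
    using permutes_in_image[OF \<sigma>, of i] permutes_not_in[OF \<sigma>, of i] by force
  have \<tau>0: "\<tau> i = 0 \<longleftrightarrow> i = 0" for i
    using permutes_in_image[OF \<tau>, of i] permutes_not_in[OF \<tau>, of i] by force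
  have "inj_on \<rho> {1..k + l}"
  proof (rule inj_onI)
    fix i j assume "\<rho> i = \<rho> j"
    moreover have "\<rho> i \<le> k \<longleftrightarrow> i \<le> k" for i
      using \<tau>0[of "i - k"] by (auto simp: \<rho>_def \<sigma>_le)
    ultimately have "i \<le> k \<longleftrightarrow> j \<le> k" by metis
    then show "i = j"
      using \<open>\<rho> i = \<rho> j\<close> injD[OF permutes_inj[OF \<sigma>], of i j]
        injD[OF permutes_inj[OF \<tau>], of "i - k" "j - k"]
      by (cases "i \<le> k") (simp_all add: \<rho>_def)
  qed
  moreover have "\<rho> i \<in> {1..k + l}" if "i \<in> {1..k + l}" for i
    using that permutes_in_image[OF \<sigma>, of i] permutes_in_image[OF \<tau>, of "i - k"]
    by (auto simp: \<rho>_def)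
  then have "\<rho> ` {1..k + l} \<subseteq> {1..k + l}" by blast
  moreover have "\<rho> i = i" if "i \<notin> {1..k + l}" for i
  proof (cases "i = 0")
    case True
    then show ?thesis using permutes_not_in[OF \<sigma>, of 0] by (simp add: \<rho>_def)
  next
    case False
    then have "\<not> i \<le> k" "i - k \<notin> {1..l}" using that by auto
    then show ?thesis using permutes_not_in[OF \<tau>, of "i - k"] by (simp add: \<rho>_def)
  qed
  ultimately have \<rho>: "\<rho> permutes {1..k + l}"
    by (intro bij_imp_permutes) (simp_all add: bij_betw_def endo_inj_surj)
  have "relabel ((+) k \<circ> \<tau>) q = relabel (\<rho> \<circ> (+) k) q"
    by (rule relabel_cong[OF q]) (auto simp: \<rho>_def)
  moreover have "relabel \<sigma> p = relabel \<rho> p"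
    by (rule relabel_cong[OF p]) (auto simp: \<rho>_def)
  moreover have "relabel \<rho> (r \<union> r') = relabel \<rho> r \<union> relabel \<rho> r'" for r r'
    by (simp add: relabel_def image_Un)
  ultimately have "relabel \<sigma> p \<otimes>\<^sub>P relabel \<tau> q = relabel \<rho> (p \<otimes>\<^sub>P q)"
    unfolding juxtapose_def deg_eq[OF p] deg_eq[OF relabel_partitions[OF p \<sigma>]] relabel_comp
    by (simp add: relabel_comp)
  then show ?thesis
    using orb_relabel[OF juxtapose_partitions[OF p q] \<rho>] by simp
qed

lemma orbit_mult_orb:
  assumes "p \<in> partitions k" "q \<in> partitions l"
  shows "orbit_mult (orb p) (orb q) = orb (p \<otimes>\<^sub>P q)"
  unfolding orbit_mult_def
proof (rule the_equality)
  show "\<exists>k l. \<exists>p'\<in>partitions k. \<exists>q'\<in>partitions l.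
      orb p = orb p' \<and> orb q = orb q' \<and> orb (p \<otimes>\<^sub>P q) = orb (p' \<otimes>\<^sub>P q')"
    using assms by blast
next
  fix R assume "\<exists>k l. \<exists>p'\<in>partitions k. \<exists>q'\<in>partitions l.
      orb p = orb p' \<and> orb q = orb q' \<and> R = orb (p' \<otimes>\<^sub>P q')"
  then show "R = orb (p \<otimes>\<^sub>P q)"
    using orb_eqD(2)[OF assms(1)] orb_eqD(2)[OF assms(2)] orb_juxtapose_cong[OF assms] by metis
qed


section \<open>The structure on \<open>\<Oplus>\<^sub>k \<complex>[\<P>\<^sub>k / \<SS>\<^sub>k]\<close>\<close>

type_synonym orbit_space = "diagram_orbit \<Rightarrow>\<^sub>0 complex"
type_synonym orbit_space2 = "(diagram_orbit \<times> diagram_orbit) \<Rightarrow>\<^sub>0 complex"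

definition orbit_component :: "nat \<Rightarrow> orbit_space set"
  where "orbit_component k = free.span (basis ` orbits k)"

definition orbit_product :: "orbit_space2 \<Rightarrow> orbit_space"
  where "orbit_product = lin_ext scale (\<lambda>(P, Q). basis (orbit_mult P Q))"

definition orbit_unit :: orbit_space
  where "orbit_unit = basis (orb {})"

text \<open>
  \<open>nths ps I\<close> is the sublist of \<open>ps\<close> at the (zero-based) positions in \<open>I\<close>. Since the formula is
  imposed for all representatives, the description determines at most one linear map, and such a
  map exists only if the formula is independent of the representative.
\<close>

definition boxplus_coproduct :: "orbit_space \<Rightarrow> orbit_space2"
  where "boxplus_coproduct = (THE D. Vector_Spaces.linear scale scale D \<and>
    (\<forall>ps. (\<forall>p\<in>set ps. irreducible_diagram p) \<longrightarrow>
      D (basis (orb (juxtapose_list ps))) =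
        (\<Sum>I\<in>Pow {..<length ps}.
          tensor (basis (orb (juxtapose_list (nths ps I))))
                 (basis (orb (juxtapose_list (nths ps ({..<length ps} - I))))))))"

definition boxplus_counit :: "orbit_space \<Rightarrow> complex"
  where "boxplus_counit = lin_ext (*) (\<lambda>P. if P = orb {} then 1 else 0)"

end

theory Submission
  imports Defs "HOL-Library.Product_Plus" "HOL-Library.Multiset"
begin

text \<open>
  Under \<open>\<otimes>\<close> the orbits form a commutative monoid, and this monoid is free on the irreducible orbits.
  Indeed, call two blocks of \<open>p\<close> linked when they share an index; the number of connected components
  of \<open>p\<close> isomorphic to a given irreducible \<open>q\<close> is invariant under relabelling and additive under
  \<open>\<otimes>\<close>, so it recovers the multiplicity of \<open>[q]\<close> in any factorisation of \<open>[p]\<close>. Hence the space is a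
  polynomial algebra on the irreducible orbits \<open>g\<close>, and expanding the product
  \<open>\<Prod>\<^sub>i (g\<^sub>i \<otimes> 1 + 1 \<otimes> g\<^sub>i)\<close> identifies the coproduct with the algebra homomorphism that makes every
  \<open>g\<close> primitive. All Hopf algebra axioms, with antipode \<open>g \<mapsto> -g\<close>, are equalities of algebra
  homomorphisms, which need to be checked on generators only.
\<close>

section \<open>Monoid algebras\<close>

text \<open>The coproduct is a definite description, so it says nothing until some linear map is
  known to satisfy the formula for every choice of irreducible representatives. That every orbit
  factors only makes such a map unique; its existence is where uniqueness of the factorisation is
  needed. Making the orbits an instance of \<open>comm_monoid_add\<close> provides the convolution
  ring, and since pairs of monoid elements form a monoid again, the tensor powers are monoid
  algebras too and the same lemmas serve source and target of each structure map. Commutativity is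
  what lets the antipode identities be checked on generators: the product is an algebra homomorphism
  on the tensor square because factors may be interchanged. Associativity of the product and its
  compatibility with the coproduct are instead compared on basis elements. The grading does double
  duty. Natural degrees that vanish only at \<open>0\<close> give connectedness, and they exclude
  nontrivial invertible orbits, on which multiplicativity of the counit rests.\<close>

text \<open>
  For a commutative monoid \<open>'a\<close>, the library makes \<open>'a \<Rightarrow>\<^sub>0 'k\<close> a commutative ring under convolution,
  the monoid algebra of \<open>'a\<close>.
\<close>

lemma basis_0: "basis 0 = 1"
  by (simp add: basis_def)

lemma basis_add: "basis (a + b) = basis a * basis b"
  by (simp add: basis_def mult_single)

text \<open>Turns scalar multiplication into ring multiplication, so that moving scalars through
  products becomes a rearrangement in a commutative ring.\<close>

lemma scale_conv_single: "scale c x = Poly_Mapping.single 0 c * x"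
proof -
  have "Poly_Mapping.single 0 c * (\<Sum>b\<in>Poly_Mapping.keys x. scale (Poly_Mapping.lookup x b) (basis b)) =
    (\<Sum>b\<in>Poly_Mapping.keys x. scale c (scale (Poly_Mapping.lookup x b) (basis b)))"
    unfolding sum_distrib_left
  proof (intro sum.cong refl)
    fix b
    have s: "scale u (Poly_Mapping.single v w) = Poly_Mapping.single v (u * w)" for u w :: 'b and v :: 'a
      by (rule poly_mapping_eqI) (simp add: lookup_single when_def)
    show "Poly_Mapping.single 0 c * scale (Poly_Mapping.lookup x b) (basis b) =
        scale c (scale (Poly_Mapping.lookup x b) (basis b))"
      by (simp add: s basis_def mult_single)
  qed
  then show ?thesis
    by (simp only: free.scale_sum_right[symmetric] free_expand[symmetric])
qed

lemma scale_mult_left: "scale c x * y = scale c (x * y)"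
  and scale_mult_right: "x * scale c y = scale c (x * y)"
  for x y :: "'a::comm_monoid_add \<Rightarrow>\<^sub>0 'k::field"
  by (simp_all add: scale_conv_single ac_simps)

abbreviation lin :: "(('a \<Rightarrow>\<^sub>0 'k::field) \<Rightarrow> ('b \<Rightarrow>\<^sub>0 'k)) \<Rightarrow> bool"
  where "lin \<equiv> Vector_Spaces.linear scale scale"

lemma linI:
  assumes "\<And>x y. F (x + y) = F x + F y" "\<And>c x. F (scale c x) = scale c (F x)"
  shows "lin F"
  unfolding Vector_Spaces.linear_iff using assms by (simp add: free.vector_space_axioms)

lemma
  assumes "lin F"
  shows lin_add: "F (x + y) = F x + F y"
    and lin_scale: "F (scale c x) = scale c (F x)"
    and lin_sum: "F (\<Sum>i\<in>I. h i) = (\<Sum>i\<in>I. F (h i))"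
proof -
  interpret Vector_Spaces.linear scale scale F by fact
  show "F (x + y) = F x + F y" "F (scale c x) = scale c (F x)"
    "F (\<Sum>i\<in>I. h i) = (\<Sum>i\<in>I. F (h i))"
    by (simp_all add: add scale sum)
qed

lemma lin_id: "lin id"
  by (rule linI) auto

lemma lin_comp: "lin F \<Longrightarrow> lin G \<Longrightarrow> lin (\<lambda>x. F (G x))"
  by (rule linI) (simp_all add: lin_add lin_scale)

lemma lin_mult_right: "lin (\<lambda>x. F x * y)" if "lin F" for y :: "'b::comm_monoid_add \<Rightarrow>\<^sub>0 'k::field"
  by (rule linI) (simp_all add: that lin_add lin_scale distrib_right scale_mult_left)

lemma lin_mult_left: "lin (\<lambda>x. y * F x)" if "lin F" for y :: "'b::comm_monoid_add \<Rightarrow>\<^sub>0 'k::field"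
  by (rule linI) (simp_all add: that lin_add lin_scale distrib_left scale_mult_right)

lemma lin_lin_ext: "lin (lin_ext scale \<phi>)"
  by (rule linear_lin_ext[OF free.vector_space_axioms])

lemma lin_ext_scale_basis: "lin_ext scale \<phi> (basis b) = \<phi> b"
  by (rule lin_ext_basis[OF free.vector_space_axioms])

lemma linear_eqI_basis:
  assumes "Vector_Spaces.linear scale s F" "Vector_Spaces.linear scale s G"
    and "\<And>b. F (basis b) = G (basis b)"
  shows "F x = G x"
  using linear_eq_lin_ext[OF assms(1)] linear_eq_lin_ext[OF assms(2)] assms(3) by simp

lemma bilinear_eqI_basis:
  assumes "\<And>y. lin (\<lambda>x. F x y)" "\<And>x. lin (F x)" "\<And>y. lin (\<lambda>x. G x y)" "\<And>x. lin (G x)"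
    and "\<And>a b. F (basis a) (basis b) = G (basis a) (basis b)"
  shows "F x y = G x y"
proof -
  have "F (basis a) y = G (basis a) y" for a
    by (rule linear_eqI_basis[OF assms(2) assms(4) assms(5)])
  then show ?thesis by (rule linear_eqI_basis[OF assms(1,3)])
qed

section \<open>Algebra homomorphisms and tensor products of monoid algebras\<close>

definition alg_hom :: "(('a::comm_monoid_add \<Rightarrow>\<^sub>0 'k::field) \<Rightarrow> ('b::comm_monoid_add \<Rightarrow>\<^sub>0 'k)) \<Rightarrow> bool"
  where "alg_hom F \<longleftrightarrow> lin F \<and> F 1 = 1 \<and> (\<forall>x y. F (x * y) = F x * F y)"

lemma
  assumes "alg_hom F"
  shows alg_hom_lin: "lin F"
    and alg_hom_1: "F 1 = 1"
    and alg_hom_mult: "F (x * y) = F x * F y"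
  using assms by (auto simp: alg_hom_def)

lemma alg_homI:
  assumes "lin F" "F (basis 0) = 1" "\<And>a b. F (basis (a + b)) = F (basis a) * F (basis b)"
  shows "alg_hom F"
proof -
  have "F (x * y) = F x * F y" for x y
    by (rule bilinear_eqI_basis[where F = "\<lambda>x y. F (x * y)"])
      (auto simp: assms(3) basis_add[symmetric]
        intro!: lin_comp[OF assms(1)] lin_mult_left lin_mult_right lin_id[unfolded id_def] assms(1))
  then show ?thesis using assms(1,2) by (simp add: alg_hom_def basis_0)
qed

lemma alg_hom_lin_ext:
  assumes "\<phi> 0 = 1" "\<And>a b. \<phi> (a + b) = \<phi> a * \<phi> b"
  shows "alg_hom (lin_ext scale \<phi>)"
  by (rule alg_homI) (simp_all add: lin_lin_ext lin_ext_scale_basis assms)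

lemma alg_hom_id: "alg_hom id"
  by (simp add: alg_hom_def lin_id)

lemma alg_hom_comp: "alg_hom F \<Longrightarrow> alg_hom G \<Longrightarrow> alg_hom (\<lambda>x. F (G x))"
  by (simp add: alg_hom_def lin_comp)

lemma lookup_tensor_pair:
  "Poly_Mapping.lookup (tensor x y) c = Poly_Mapping.lookup x (fst c) * Poly_Mapping.lookup y (snd c)"
  by (metis lookup_tensor prod.collapse)

lemma lin_tensor_left: "lin (\<lambda>x. tensor x y)"
  by (rule linI; rule poly_mapping_eqI)
    (simp_all add: lookup_tensor_pair lookup_add algebra_simps)

lemma lin_tensor_right: "lin (\<lambda>y. tensor x y)"
  by (rule linI; rule poly_mapping_eqI)
    (simp_all add: lookup_tensor_pair lookup_add algebra_simps)

lemma tensor_1: "tensor 1 1 = 1"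
  using tensor_basis[of 0 0] by (simp add: basis_0 zero_prod_def[symmetric])

text \<open>Pure tensors are products \<open>l u * r v\<close> of the two embeddings into the monoid
  algebra of pairs; the claim is then a rearrangement of four factors in a commutative ring.\<close>

lemma tensor_mult: "tensor x y * tensor x' y' = tensor (x * x') (y * y')"
  for x x' :: "'a::comm_monoid_add \<Rightarrow>\<^sub>0 'k::field" and y y' :: "'b::comm_monoid_add \<Rightarrow>\<^sub>0 'k"
proof -
  define l :: "('a \<Rightarrow>\<^sub>0 'k) \<Rightarrow> ('a \<times> 'b) \<Rightarrow>\<^sub>0 'k" where "l = lin_ext scale (\<lambda>a. basis (a, 0))"
  define r :: "('b \<Rightarrow>\<^sub>0 'k) \<Rightarrow> ('a \<times> 'b) \<Rightarrow>\<^sub>0 'k" where "r = lin_ext scale (\<lambda>b. basis (0, b))"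
  have l: "alg_hom l" unfolding l_def
    by (rule alg_hom_lin_ext) (simp_all add: basis_add[symmetric] basis_0 zero_prod_def[symmetric])
  have r: "alg_hom r" unfolding r_def
    by (rule alg_hom_lin_ext) (simp_all add: basis_add[symmetric] basis_0 zero_prod_def[symmetric])
  have *: "tensor u v = l u * r v" for u v
  proof (rule bilinear_eqI_basis[where F = tensor and G = "\<lambda>u v. l u * r v"])
    show "tensor (basis a) (basis b) = l (basis a) * r (basis b)" for a b
      by (simp add: tensor_basis l_def r_def lin_ext_scale_basis basis_add[symmetric])
  qed (intro lin_tensor_left lin_tensor_right lin_mult_left lin_mult_right alg_hom_lin[OF l]
      alg_hom_lin[OF r])+
  show ?thesis
    by (simp add: * alg_hom_mult[OF l] alg_hom_mult[OF r] ac_simps)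
qed

lemma lin_tensor_map: "lin (tensor_map F G)"
  unfolding tensor_map_def by (rule lin_lin_ext)

lemma tensor_map_basis: "tensor_map F G (basis (a, b)) = tensor (F (basis a)) (G (basis b))"
  by (simp add: tensor_map_def lin_ext_scale_basis)

lemma alg_hom_tensor_map:
  assumes "alg_hom F" "alg_hom G"
  shows "alg_hom (tensor_map F G)"
proof (rule alg_homI[OF lin_tensor_map])
  show "tensor_map F G (basis 0) = 1"
    by (simp add: zero_prod_def tensor_map_basis basis_0 alg_hom_1[OF assms(1)] alg_hom_1[OF assms(2)]
        tensor_1)
  show "tensor_map F G (basis (a + b)) = tensor_map F G (basis a) * tensor_map F G (basis b)" for a b
    by (cases a; cases b)
      (simp add: tensor_map_basis tensor_mult basis_add alg_hom_mult[OF assms(1)] alg_hom_mult[OF assms(2)])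
qed

lemma lin_assoc_iso: "lin assoc_iso"
  unfolding assoc_iso_def by (rule lin_lin_ext)

lemma assoc_iso_basis: "assoc_iso (basis ((a, b), c)) = basis (a, (b, c))"
  by (simp add: assoc_iso_def lin_ext_scale_basis)

lemma alg_hom_assoc_iso: "alg_hom assoc_iso"
  by (rule alg_homI[OF lin_assoc_iso])
    (auto simp: zero_prod_def assoc_iso_basis basis_add[symmetric], simp add: basis_0 zero_prod_def[symmetric])

definition mul :: "(('a::comm_monoid_add \<times> 'a) \<Rightarrow>\<^sub>0 'k::field) \<Rightarrow> ('a \<Rightarrow>\<^sub>0 'k)"
  where "mul = lin_ext scale (\<lambda>(a, b). basis (a + b))"

lemma mul_basis: "mul (basis (a, b)) = basis (a + b)"
  by (simp add: mul_def lin_ext_scale_basis)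

lemma lin_mul: "lin mul"
  unfolding mul_def by (rule lin_lin_ext)

text \<open>Holds because the monoid is commutative: the two middle terms of a fourfold sum may be
  interchanged. This puts the left sides of the antipode identities within reach of a check on
  generators.\<close>

lemma alg_hom_mul: "alg_hom mul"
  by (rule alg_homI[OF lin_mul])
    (simp add: zero_prod_def mul_basis basis_0, auto simp: mul_basis basis_add[symmetric] ac_simps)

lemma mul_tensor: "mul (tensor x y) = x * y"
  for x y :: "'a::comm_monoid_add \<Rightarrow>\<^sub>0 'k::field"
proof (rule bilinear_eqI_basis[where F = "\<lambda>x y. mul (tensor x y)" and G = "(*)"])
  show "mul (tensor (basis a) (basis b)) = basis a * basis b" for a b :: 'a
    by (simp add: tensor_basis mul_basis basis_add)
qed (intro lin_comp[OF lin_mul] lin_tensor_left lin_tensor_right lin_mult_left lin_mult_right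
      lin_id[unfolded id_def])+

lemma lin_middle_swap: "lin middle_swap"
  unfolding middle_swap_def by (rule lin_lin_ext)

text \<open>The usual product of a tensor square of algebras is convolution over the monoid of
  pairs. The compatibility axiom thereby becomes multiplicativity of the coproduct.\<close>

lemma mul_middle_swap: "tensor_map mul mul (middle_swap (tensor x y)) = x * y"
  for x y :: "('a::comm_monoid_add \<times> 'a) \<Rightarrow>\<^sub>0 'k::field"
proof (rule bilinear_eqI_basis[where F = "\<lambda>x y. tensor_map mul mul (middle_swap (tensor x y))" and G = "(*)"])
  show "tensor_map mul mul (middle_swap (tensor (basis a) (basis b))) = basis a * basis b"
    for a b :: "'a \<times> 'a"
    by (cases a; cases b)
      (simp add: middle_swap_def lin_ext_scale_basis tensor_basis tensor_map_basis mul_basis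
        basis_add[symmetric])
qed (intro lin_comp[OF lin_tensor_map] lin_comp[OF lin_middle_swap] lin_tensor_left
    lin_tensor_right lin_mult_left lin_mult_right lin_id[unfolded id_def])+

lemma mul_assoc: "mul (tensor_map mul id t) = mul (tensor_map id mul (assoc_iso t))"
  for t :: "(('a::comm_monoid_add \<times> 'a) \<times> 'a) \<Rightarrow>\<^sub>0 'k::field"
proof (rule linear_eqI_basis[where F = "\<lambda>t. mul (tensor_map mul id t)"
      and G = "\<lambda>t. mul (tensor_map id mul (assoc_iso t))"])
  show "mul (tensor_map mul id (basis c)) = mul (tensor_map id mul (assoc_iso (basis c)))"
    for c :: "('a \<times> 'a) \<times> 'a"
    by (cases c; cases "fst c") (simp add: assoc_iso_basis tensor_map_basis mul_basis tensor_basis ac_simps)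
qed (rule lin_comp[OF lin_mul lin_tensor_map],
    rule lin_comp[OF lin_mul lin_comp[OF lin_tensor_map lin_assoc_iso]])

text \<open>This is the coefficient at \<open>0\<close>, not the usual augmentation that sums all
  coefficients. It is not multiplicative over every commutative monoid, so \<open>aug_mult\<close>
  has to wait for the grading.\<close>

definition aug :: "('a::comm_monoid_add \<Rightarrow>\<^sub>0 'k::field) \<Rightarrow> 'k"
  where "aug = lin_ext (*) (\<lambda>a. if a = 0 then 1 else 0)"

lemma vector_space_field: "vector_space ((*) :: 'k::field \<Rightarrow> 'k \<Rightarrow> 'k)"
  by unfold_locales (auto simp: algebra_simps)

lemma linear_aug: "Vector_Spaces.linear scale (*) aug"
  unfolding aug_def by (rule linear_lin_ext[OF vector_space_field])

lemma aug_basis: "aug (basis a) = (if a = 0 then 1 else 0)"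
  by (simp add: aug_def lin_ext_basis[OF vector_space_field])

lemma aug_add: "aug (x + y) = aug x + aug y"
  and aug_scale: "aug (scale c x) = c * aug x"
  for x y :: "'a::comm_monoid_add \<Rightarrow>\<^sub>0 'k::field"
proof -
  interpret Vector_Spaces.linear scale "(*)" "aug :: ('a \<Rightarrow>\<^sub>0 'k) \<Rightarrow> 'k"
    by (rule linear_aug)
  show "aug (x + y) = aug x + aug y" "aug (scale c x) = c * aug x"
    by (rule add scale)+
qed


section \<open>Gradings of monoid algebras\<close>

text \<open>A condition on the support instead of a span, so that membership can be tested
  coefficient by coefficient; \<open>span_basis\<close> links it with the span.\<close>

definition homogeneous :: "('a \<Rightarrow> nat) \<Rightarrow> nat \<Rightarrow> ('a \<Rightarrow>\<^sub>0 'k::field) set"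
  where "homogeneous d n = {x. \<forall>a\<in>Poly_Mapping.keys x. d a = n}"

lemma homogeneousD: "x \<in> homogeneous d n \<Longrightarrow> Poly_Mapping.lookup x a \<noteq> 0 \<Longrightarrow> d a = n"
  by (auto simp: homogeneous_def in_keys_iff)

lemma homogeneousI: "(\<And>a. Poly_Mapping.lookup x a \<noteq> 0 \<Longrightarrow> d a = n) \<Longrightarrow> x \<in> homogeneous d n"
  by (auto simp: homogeneous_def in_keys_iff)

lemma basis_homogeneous: "basis a \<in> homogeneous d n \<longleftrightarrow> d a = n"
  by (auto simp: homogeneous_def basis_def)

lemma subspace_homogeneous: "free.subspace (homogeneous d n :: ('a \<Rightarrow>\<^sub>0 'k::field) set)"
proof (rule free.subspaceI)
  show "x + y \<in> homogeneous d n" if "x \<in> homogeneous d n" "y \<in> homogeneous d n" for x y :: "'a \<Rightarrow>\<^sub>0 'k"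
  proof (rule homogeneousI)
    fix a assume "Poly_Mapping.lookup (x + y) a \<noteq> 0"
    then have "Poly_Mapping.lookup x a \<noteq> 0 \<or> Poly_Mapping.lookup y a \<noteq> 0"
      by (auto simp: lookup_add)
    then show "d a = n"
      using homogeneousD[OF that(1), of a] homogeneousD[OF that(2), of a] by auto
  qed
  show "scale c x \<in> homogeneous d n" if "x \<in> homogeneous d n" for c and x :: "'a \<Rightarrow>\<^sub>0 'k"
    by (rule homogeneousI) (use homogeneousD[OF that] in auto)
qed (simp add: homogeneous_def)

lemma span_basis: "free.span (basis ` {a. d a = n}) = homogeneous d n"
proof
  show "free.span (basis ` {a. d a = n}) \<subseteq> homogeneous d n"
    by (rule free.span_minimal) (auto simp: basis_homogeneous subspace_homogeneous)
  show "homogeneous d n \<subseteq> free.span (basis ` {a. d a = n})"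
  proof
    fix x assume x: "x \<in> homogeneous d n"
    have "(\<Sum>b\<in>Poly_Mapping.keys x. scale (Poly_Mapping.lookup x b) (basis b)) \<in>
        free.span (basis ` {a. d a = n})"
      using x by (intro free.span_sum free.span_scale free.span_base) (auto simp: homogeneous_def)
    then show "x \<in> free.span (basis ` {a. d a = n})"
      by (simp only: free_expand[symmetric])
  qed
qed

lemma lin_homogeneous:
  assumes "lin F" "\<And>a. F (basis a) \<in> homogeneous e (d a)" "x \<in> homogeneous d n"
  shows "F x \<in> homogeneous e n"
proof -
  have "F x = (\<Sum>b\<in>Poly_Mapping.keys x. scale (Poly_Mapping.lookup x b) (F (basis b)))"
    using arg_cong[OF free_expand, of F x] by (simp only: lin_sum[OF assms(1)] lin_scale[OF assms(1)])
  also have "\<dots> \<in> homogeneous e n"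
  proof (intro free.subspace_sum free.subspace_scale subspace_homogeneous)
    fix b assume "b \<in> Poly_Mapping.keys x"
    then have "d b = n" using assms(3) by (simp add: homogeneous_def)
    then show "F (basis b) \<in> homogeneous e n" using assms(2) by blast
  qed
  finally show ?thesis .
qed

lemma mult_homogeneous:
  assumes "\<And>a b. d (a + b) = d a + d b" "x \<in> homogeneous d m" "y \<in> homogeneous d n"
  shows "x * y \<in> homogeneous d (m + n)"
proof -
  have "d c = m + n" if c: "c \<in> Poly_Mapping.keys (x * y)" for c
  proof -
    obtain a b where "c = a + b" "a \<in> Poly_Mapping.keys x" "b \<in> Poly_Mapping.keys y"
      using c keys_mult[of x y] by blast
    then show ?thesis using assms by (simp add: homogeneous_def)
  qed
  then show ?thesis by (simp add: homogeneous_def)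
qed

lemma homogeneous_tensor_span:
  fixes t :: "('a \<times> 'a) \<Rightarrow>\<^sub>0 'k::field"
  assumes "t \<in> homogeneous (\<lambda>(a, b). d a + d b) n"
  shows "t \<in> free.span {tensor y z | y z i j. y \<in> homogeneous d i \<and> z \<in> homogeneous d j \<and> i + j = n}"
    (is "_ \<in> free.span ?T")
proof -
  have "basis ` {c. (\<lambda>(a, b). d a + d b) c = n} \<subseteq> ?T"
  proof
    fix u :: "('a \<times> 'a) \<Rightarrow>\<^sub>0 'k" assume "u \<in> basis ` {c. (\<lambda>(a, b). d a + d b) c = n}"
    then obtain a b where "u = basis (a, b)" "d a + d b = n" by auto
    then have "u = tensor (basis a) (basis b)" "basis a \<in> homogeneous d (d a)"
      "basis b \<in> homogeneous d (d b)"
      by (simp_all add: tensor_basis basis_homogeneous)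
    with \<open>d a + d b = n\<close> show "u \<in> ?T" by blast
  qed
  then show ?thesis
    using assms free.span_mono unfolding span_basis[symmetric] by blast
qed

lemma homogeneous_direct_sum:
  "\<exists>!c. (\<forall>n. c n \<in> homogeneous d n) \<and> finite {n. c n \<noteq> 0} \<and> x = (\<Sum>n | c n \<noteq> 0. c n)"
proof (rule ex1I)
  define c where "c n = (\<Sum>b | b \<in> Poly_Mapping.keys x \<and> d b = n.
      scale (Poly_Mapping.lookup x b) (basis b))" for n
  have lc: "Poly_Mapping.lookup (c n) a = (if d a = n then Poly_Mapping.lookup x a else 0)" for n a
    by (simp add: c_def lookup_sum lookup_basis if_distrib sum.delta in_keys_iff cong: if_cong)
  have sub: "{n. c n \<noteq> 0} \<subseteq> d ` Poly_Mapping.keys x"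
  proof
    fix n assume "n \<in> {n. c n \<noteq> 0}"
    then obtain a where "Poly_Mapping.lookup (c n) a \<noteq> 0"
      by (metis lookup_zero mem_Collect_eq poly_mapping_eqI)
    then show "n \<in> d ` Poly_Mapping.keys x" by (auto simp: lc in_keys_iff split: if_splits)
  qed
  then have fin: "finite {n. c n \<noteq> 0}" by (rule finite_subset) simp
  have "Poly_Mapping.lookup (\<Sum>n | c n \<noteq> 0. c n) a = Poly_Mapping.lookup x a" for a
  proof -
    have "Poly_Mapping.lookup x a = 0" if "c (d a) = 0"
      using that lc[of "d a" a] by simp
    then show ?thesis using fin by (auto simp: lookup_sum lc sum.delta)
  qed
  then have "x = (\<Sum>n | c n \<noteq> 0. c n)" by (metis poly_mapping_eqI)
  moreover have "c n \<in> homogeneous d n" for n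
    by (rule homogeneousI) (simp add: lc split: if_splits)
  ultimately show "(\<forall>n. c n \<in> homogeneous d n) \<and> finite {n. c n \<noteq> 0} \<and> x = (\<Sum>n | c n \<noteq> 0. c n)"
    using fin by blast
  fix e assume e: "(\<forall>n. e n \<in> homogeneous d n) \<and> finite {n. e n \<noteq> 0} \<and> x = (\<Sum>n | e n \<noteq> 0. e n)"
  have le: "Poly_Mapping.lookup (e n) a = (if d a = n then Poly_Mapping.lookup (e n) a else 0)" for n a
    using homogeneousD[of "e n" d n a] e by auto
  \<comment> \<open>Only the summand of degree \<open>d a\<close> can contribute to the coefficient
    at \<open>a\<close>, so \<open>x\<close> determines every coefficient of every
    \<open>e n\<close>.\<close>
  have lx: "Poly_Mapping.lookup x a = Poly_Mapping.lookup (e (d a)) a" for a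
  proof -
    have "Poly_Mapping.lookup x a = (\<Sum>n | e n \<noteq> 0. Poly_Mapping.lookup (e n) a)"
      using e by (metis lookup_sum)
    also have "\<dots> = (\<Sum>n | e n \<noteq> 0. if d a = n then Poly_Mapping.lookup (e n) a else 0)"
      by (intro sum.cong refl le)
    also have "\<dots> = Poly_Mapping.lookup (e (d a)) a"
      using e by (auto simp: sum.delta)
    finally show ?thesis .
  qed
  show "e = c"
  proof (intro ext poly_mapping_eqI)
    show "Poly_Mapping.lookup (e n) a = Poly_Mapping.lookup (c n) a" for n a
      using le[of n a] by (auto simp: lc lx split: if_splits)
  qed
qed


section \<open>The Hopf algebra of a graded free commutative monoid\<close>

text \<open>Freeness is encoded by a left inverse of summation: \<open>factors\<close> is additive,
  \<open>sum_mset\<close> undoes it, and \<open>g\<close> counts as a generator when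
  \<open>factors g = {#g#}\<close>. The last assumption makes the algebra connected and excludes
  nontrivial invertible elements.\<close>

locale graded_free_monoid =
  fixes factors :: "'m::comm_monoid_add \<Rightarrow> 'm multiset"
    and d :: "'m \<Rightarrow> nat"
  assumes factors_0: "factors 0 = {#}"
    and factors_add: "factors (a + b) = factors a + factors b"
    and factors_factor: "g \<in># factors a \<Longrightarrow> factors g = {#g#}"
    and sum_factors: "sum_mset (factors a) = a"
    and d_add: "d (a + b) = d a + d b"
    and d_eq_0: "d a = 0 \<Longrightarrow> a = 0"
begin

lemma d_0: "d 0 = 0"
  using d_add[of 0 0] by simp

lemma prime_neq_0: "factors g = {#g#} \<Longrightarrow> g \<noteq> 0"
  using factors_0 by auto

text \<open>Natural degrees cannot cancel. This is the fact behind multiplicativity of the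
  counit.\<close>

lemma sum_eq_0: "a + b = 0 \<Longrightarrow> a = 0" for a b :: 'm
  using d_add[of a b] by (simp add: d_0 d_eq_0)

lemma factorize:
  fixes a :: 'm
  shows "\<exists>M. a = sum_mset M \<and> (\<forall>g. g \<in># M \<longrightarrow> factors g = {#g#})"
  using sum_factors[of a] factors_factor[of _ a] by metis

lemma alg_hom_eqI:
  assumes F: "alg_hom F" and G: "alg_hom G"
    and eq: "\<And>g. factors g = {#g#} \<Longrightarrow> F (basis g) = G (basis g)"
  shows "F x = G x"
proof (rule linear_eqI_basis[OF alg_hom_lin[OF F] alg_hom_lin[OF G]])
  fix a :: 'm
  obtain M where M: "a = sum_mset M" "\<And>g. g \<in># M \<Longrightarrow> factors g = {#g#}"
    using factorize[of a] by blast
  show "F (basis a) = G (basis a)"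
    unfolding M(1) using M(2)
    by (induction M)
      (simp_all add: basis_0 basis_add alg_hom_1[OF F] alg_hom_1[OF G] alg_hom_mult[OF F]
        alg_hom_mult[OF G] eq)
qed

text \<open>The existence half of the universal property of a polynomial algebra, with
  \<open>alg_hom_eqI\<close> as the uniqueness half. Values of \<open>\<phi>\<close> off the
  generators never enter, since \<open>factors a\<close> contains generators only.\<close>

definition ext_hom :: "('m \<Rightarrow> ('b::comm_monoid_add \<Rightarrow>\<^sub>0 'k::field)) \<Rightarrow> ('m \<Rightarrow>\<^sub>0 'k) \<Rightarrow> ('b \<Rightarrow>\<^sub>0 'k)"
  where "ext_hom \<phi> = lin_ext scale (\<lambda>a. \<Prod>g\<in>#factors a. \<phi> g)"

lemma ext_hom_basis: "ext_hom \<phi> (basis a) = (\<Prod>g\<in>#factors a. \<phi> g)"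
  by (simp add: ext_hom_def lin_ext_scale_basis)

lemma ext_hom_prime: "factors g = {#g#} \<Longrightarrow> ext_hom \<phi> (basis g) = \<phi> g"
  by (simp add: ext_hom_basis)

lemma alg_hom_ext_hom: "alg_hom (ext_hom \<phi>)"
  unfolding ext_hom_def by (rule alg_hom_lin_ext) (simp_all add: factors_0 factors_add)

text \<open>Degrees add under multiplication on both sides, so preserving the degree of generators
  is enough. The target degree \<open>e\<close> is left general to cover the tensor square as
  well.\<close>

lemma ext_hom_homogeneous:
  assumes e: "\<And>a b. e (a + b) = e a + e b"
    and \<phi>: "\<And>g. factors g = {#g#} \<Longrightarrow> \<phi> g \<in> homogeneous e (d g)"
    and x: "x \<in> homogeneous d n"
  shows "ext_hom \<phi> x \<in> homogeneous e n"
proof (rule lin_homogeneous[OF alg_hom_lin[OF alg_hom_ext_hom] _ x])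
  fix a :: 'm
  have e0: "e 0 = 0" using e[of 0 0] by simp
  obtain M where M: "a = sum_mset M" "\<And>g. g \<in># M \<Longrightarrow> factors g = {#g#}"
    using factorize[of a] by blast
  show "ext_hom \<phi> (basis a) \<in> homogeneous e (d a)"
    unfolding M(1) using M(2)
  proof (induction M)
    case empty
    have "ext_hom \<phi> (basis 0) = basis 0"
      by (simp add: basis_0 alg_hom_1[OF alg_hom_ext_hom])
    then show ?case by (simp add: basis_homogeneous e0 d_0)
  next
    case (add g M)
    have "ext_hom \<phi> (basis (g + sum_mset M)) = \<phi> g * ext_hom \<phi> (basis (sum_mset M))"
      using add.prems by (simp add: basis_add alg_hom_mult[OF alg_hom_ext_hom] ext_hom_prime)
    also have "\<dots> \<in> homogeneous e (d g + d (sum_mset M))"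
      using add by (intro mult_homogeneous e \<phi>) auto
    finally show ?case by (simp add: d_add)
  qed
qed

section \<open>Coproduct, antipode and counit of the free commutative monoid\<close>

definition comult :: "('m \<Rightarrow>\<^sub>0 'k::field) \<Rightarrow> ('m \<times> 'm) \<Rightarrow>\<^sub>0 'k"
  where "comult = ext_hom (\<lambda>g. basis (g, 0) + basis (0, g))"

text \<open>The sign is forced by primitivity: at a generator the antipode identity reads S(g) + g =
  0. A product of r generators is multiplied by the r-th power of -1.\<close>

definition antipode :: "('m \<Rightarrow>\<^sub>0 'k::field) \<Rightarrow> ('m \<Rightarrow>\<^sub>0 'k)"
  where "antipode = ext_hom (\<lambda>g. - basis g)"

lemma alg_hom_comult: "alg_hom comult"
  unfolding comult_def by (rule alg_hom_ext_hom)

lemma alg_hom_antipode: "alg_hom antipode"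
  unfolding antipode_def by (rule alg_hom_ext_hom)

lemma comult_prime: "factors g = {#g#} \<Longrightarrow> comult (basis g) = basis (g, 0) + basis (0, g)"
  unfolding comult_def by (rule ext_hom_prime)

lemma antipode_prime: "factors g = {#g#} \<Longrightarrow> antipode (basis g) = - basis g"
  unfolding antipode_def by (rule ext_hom_prime)

lemma aug_mult: "aug (x * y) = aug x * aug (y :: 'm \<Rightarrow>\<^sub>0 'k::field)"
proof -
  have b: "aug (basis a * y) = aug (basis a) * aug (y :: 'm \<Rightarrow>\<^sub>0 'k)" for a y
  proof (rule linear_eqI_basis[where F = "\<lambda>y. aug (basis a * y)" and G = "\<lambda>y. aug (basis a) * aug y"])
    show "Vector_Spaces.linear scale (*) (\<lambda>y. aug (basis a * y) :: 'k)"
      and "Vector_Spaces.linear scale (*) (\<lambda>y. aug (basis a) * aug y :: 'k)"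
      by (auto simp: Vector_Spaces.linear_iff free.vector_space_axioms vector_space_field aug_add aug_scale
          distrib_left scale_mult_right)
    have "a + b = 0 \<longleftrightarrow> a = 0 \<and> b = 0" for b
      using sum_eq_0[of a b] by auto
    then show "aug (basis a * basis b) = (aug (basis a) * aug (basis b) :: 'k)" for b
      by (simp add: basis_add[symmetric] aug_basis)
  qed
  show ?thesis
  proof (rule linear_eqI_basis[where F = "\<lambda>x. aug (x * y)" and G = "\<lambda>x. aug x * aug y"])
    show "Vector_Spaces.linear scale (*) (\<lambda>x. aug (x * y))"
      and "Vector_Spaces.linear scale (*) (\<lambda>x. aug x * aug y)"
      by (auto simp: Vector_Spaces.linear_iff free.vector_space_axioms vector_space_field aug_add aug_scale
          distrib_right scale_mult_left)
  qed (rule b)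
qed

lemma aug_1: "aug (1 :: 'm \<Rightarrow>\<^sub>0 'k::field) = 1"
  by (simp add: basis_0[symmetric] aug_basis)

lemma alg_hom_contract_left: "alg_hom (contract_left (aug :: ('m \<Rightarrow>\<^sub>0 'k::field) \<Rightarrow> 'k))"
  unfolding contract_left_def
  by (rule alg_hom_lin_ext)
    (auto simp: zero_prod_def aug_mult aug_1 basis_0 basis_add scale_mult_left scale_mult_right)

lemma alg_hom_contract_right: "alg_hom (contract_right (aug :: ('m \<Rightarrow>\<^sub>0 'k::field) \<Rightarrow> 'k))"
  unfolding contract_right_def
  by (rule alg_hom_lin_ext)
    (auto simp: zero_prod_def aug_mult aug_1 basis_0 basis_add scale_mult_left scale_mult_right mult.commute)

text \<open>Makes the right side of the antipode identities an algebra homomorphism, as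
  \<open>alg_hom_eqI\<close> requires.\<close>

lemma alg_hom_scale_aug: "alg_hom (\<lambda>x :: 'm \<Rightarrow>\<^sub>0 'k. scale (aug x) (1 :: 'm \<Rightarrow>\<^sub>0 'k::field))"
  unfolding alg_hom_def
  by (auto intro!: linI simp: aug_add aug_scale aug_mult aug_1 free.scale_left_distrib
      scale_mult_left scale_mult_right mult.commute)

text \<open>At a generator both sides are the sum of three terms, with \<open>g\<close> in one slot
  and \<open>0\<close> in the other two.\<close>

lemma comult_coassoc: "assoc_iso (tensor_map comult id (comult x)) = tensor_map id comult (comult x)"
proof (rule alg_hom_eqI)
  fix g assume g: "factors g = {#g#}"
  have c0: "comult (basis 0) = basis (0, 0)"
    by (simp add: basis_0 alg_hom_1[OF alg_hom_comult] zero_prod_def[symmetric])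
  show "assoc_iso (tensor_map comult id (comult (basis g))) = tensor_map id comult (comult (basis g))"
    by (simp add: comult_prime[OF g] c0 lin_add[OF lin_tensor_map] tensor_map_basis
        lin_add[OF lin_assoc_iso] lin_add[OF lin_tensor_left] lin_add[OF lin_tensor_right]
        tensor_basis assoc_iso_basis)
qed (rule alg_hom_comp[OF alg_hom_assoc_iso
        alg_hom_comp[OF alg_hom_tensor_map[OF alg_hom_comult alg_hom_id] alg_hom_comult]],
    rule alg_hom_comp[OF alg_hom_tensor_map[OF alg_hom_id alg_hom_comult] alg_hom_comult])

text \<open>At a generator exactly one of the two summands of the coproduct survives, because
  \<open>aug\<close> vanishes at \<open>g\<close> and is 1 at \<open>0\<close>.\<close>

lemma comult_counit:
  "contract_left aug (comult x) = x" "contract_right aug (comult x) = x"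
proof -
  show "contract_left aug (comult x) = x"
  proof (rule alg_hom_eqI[where G = "\<lambda>x. x"])
    show "contract_left aug (comult (basis g)) = basis g" if g: "factors g = {#g#}" for g
      using prime_neq_0[OF g]
      by (simp add: comult_prime[OF g] lin_add[OF alg_hom_lin[OF alg_hom_contract_left]])
        (simp add: contract_left_def lin_ext_scale_basis aug_basis)
  qed (rule alg_hom_comp[OF alg_hom_contract_left alg_hom_comult], rule alg_hom_id[unfolded id_def])
  show "contract_right aug (comult x) = x"
  proof (rule alg_hom_eqI[where G = "\<lambda>x. x"])
    show "contract_right aug (comult (basis g)) = basis g" if g: "factors g = {#g#}" for g
      using prime_neq_0[OF g]
      by (simp add: comult_prime[OF g] lin_add[OF alg_hom_lin[OF alg_hom_contract_right]])
        (simp add: contract_right_def lin_ext_scale_basis aug_basis)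
  qed (rule alg_hom_comp[OF alg_hom_contract_right alg_hom_comult], rule alg_hom_id[unfolded id_def])
qed

lemma comult_mul: "comult (mul t) = tensor_map mul mul (middle_swap (tensor_map comult comult t))"
  for t :: "('m \<times> 'm) \<Rightarrow>\<^sub>0 'k::field"
proof (rule linear_eqI_basis[where F = "\<lambda>t. comult (mul t)"
      and G = "\<lambda>t. tensor_map mul mul (middle_swap (tensor_map comult comult t))"])
  show "comult (mul (basis c :: _ \<Rightarrow>\<^sub>0 'k)) =
      tensor_map mul mul (middle_swap (tensor_map comult comult (basis c)))" for c
    by (cases c)
      (simp add: mul_basis tensor_map_basis mul_middle_swap basis_add alg_hom_mult[OF alg_hom_comult])
qed (rule lin_comp[OF alg_hom_lin[OF alg_hom_comult] lin_mul],
    rule lin_comp[OF lin_tensor_map lin_comp[OF lin_middle_swap lin_tensor_map]])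

text \<open>At a generator the two summands of the coproduct contribute \<open>basis g\<close> and
  \<open>- basis g\<close>, which cancel; \<open>aug\<close> vanishes there because a generator is
  not \<open>0\<close>.\<close>

lemma antipode_comult:
  "mul (tensor_map antipode id (comult x)) = scale (aug x) 1"
  "mul (tensor_map id antipode (comult x)) = scale (aug x) 1"
proof -
  show "mul (tensor_map antipode id (comult x)) = scale (aug x) 1"
  proof (rule alg_hom_eqI[OF _ alg_hom_scale_aug])
    show "mul (tensor_map antipode id (comult (basis g))) = scale (aug (basis g)) 1"
      if g: "factors g = {#g#}" for g
      using prime_neq_0[OF g]
      by (simp add: comult_prime[OF g] antipode_prime[OF g] basis_0 alg_hom_1[OF alg_hom_antipode] lin_add[OF lin_tensor_map]
          tensor_map_basis mul_tensor lin_add[OF lin_mul] aug_basis)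
  qed (rule alg_hom_comp[OF alg_hom_mul
        alg_hom_comp[OF alg_hom_tensor_map[OF alg_hom_antipode alg_hom_id] alg_hom_comult]])
  show "mul (tensor_map id antipode (comult x)) = scale (aug x) 1"
  proof (rule alg_hom_eqI[OF _ alg_hom_scale_aug])
    show "mul (tensor_map id antipode (comult (basis g))) = scale (aug (basis g)) 1"
      if g: "factors g = {#g#}" for g
      using prime_neq_0[OF g]
      by (simp add: comult_prime[OF g] antipode_prime[OF g] basis_0 alg_hom_1[OF alg_hom_antipode] lin_add[OF lin_tensor_map]
          tensor_map_basis mul_tensor lin_add[OF lin_mul] aug_basis)
  qed (rule alg_hom_comp[OF alg_hom_mul
        alg_hom_comp[OF alg_hom_tensor_map[OF alg_hom_id alg_hom_antipode] alg_hom_comult]])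
qed

lemma comult_homogeneous:
  assumes "x \<in> homogeneous d n"
  shows "comult x \<in> homogeneous (\<lambda>(a, b). d a + d b) n"
  unfolding comult_def
proof (rule ext_hom_homogeneous[OF _ _ assms])
  show "basis (g, 0) + basis (0, g) \<in> homogeneous (\<lambda>(a, b). d a + d b) (d g)" for g
    by (rule free.subspace_add[OF subspace_homogeneous]) (simp_all add: basis_homogeneous d_0)
qed (auto simp: d_add)

lemma antipode_homogeneous: "x \<in> homogeneous d n \<Longrightarrow> antipode x \<in> homogeneous d n"
  unfolding antipode_def
  by (rule ext_hom_homogeneous)
    (auto simp: d_add basis_homogeneous intro!: free.subspace_neg[OF subspace_homogeneous])

lemma dim_homogeneous_0: "free.dim (homogeneous d 0 :: ('m \<Rightarrow>\<^sub>0 'k::field) set) = 1"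
proof -
  have "{a. d a = 0} = {0}" using d_0 d_eq_0 by auto
  then have "homogeneous d 0 = free.span {1 :: 'm \<Rightarrow>\<^sub>0 'k}"
    by (simp add: span_basis[symmetric] basis_0)
  then show ?thesis
    by (simp add: free.dim_span_eq_card_independent del: free.dim_span)
qed

theorem graded_connected_hopf_algebra:
  "graded_connected_hopf_algebra (homogeneous d) mul (1 :: 'm \<Rightarrow>\<^sub>0 'k::field) comult aug"
proof (intro graded_connected_hopf_algebra.intro graded_hopf_algebra.intro graded_bialgebra.intro
    bialgebra.intro unital_algebra.intro counital_coalgebra.intro vector_space_grading.intro
    graded_connected_hopf_algebra_axioms.intro graded_hopf_algebra_axioms.intro
    graded_bialgebra_axioms.intro bialgebra_axioms.intro)
  show "lin (mul :: ('m \<times> 'm \<Rightarrow>\<^sub>0 'k) \<Rightarrow> _)" by (rule lin_mul)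
  show "mul (tensor_map mul id t) = mul (tensor_map id mul (assoc_iso t))" for t :: "('m \<times> 'm) \<times> 'm \<Rightarrow>\<^sub>0 'k"
    by (rule mul_assoc)
  show "mul (tensor 1 x) = x" "mul (tensor x 1) = x" for x :: "'m \<Rightarrow>\<^sub>0 'k"
    by (simp_all add: mul_tensor)
  show "lin (comult :: ('m \<Rightarrow>\<^sub>0 'k) \<Rightarrow> _)" by (rule alg_hom_lin[OF alg_hom_comult])
  show "Vector_Spaces.linear scale (*) (aug :: ('m \<Rightarrow>\<^sub>0 'k) \<Rightarrow> 'k)" by (rule linear_aug)
  show "assoc_iso (tensor_map comult id (comult x)) = tensor_map id comult (comult x)" for x :: "'m \<Rightarrow>\<^sub>0 'k"
    by (rule comult_coassoc)
  show "contract_left aug (comult x) = x" "contract_right aug (comult x) = x" for x :: "'m \<Rightarrow>\<^sub>0 'k"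
    by (rule comult_counit)+
  show "comult (mul t) = tensor_map mul mul (middle_swap (tensor_map comult comult t))"
    for t :: "'m \<times> 'm \<Rightarrow>\<^sub>0 'k"
    by (rule comult_mul)
  show "comult 1 = tensor 1 (1 :: 'm \<Rightarrow>\<^sub>0 'k)"
    by (simp add: alg_hom_1[OF alg_hom_comult] tensor_1)
  show "aug (mul (tensor x y)) = aug x * aug y" for x y :: "'m \<Rightarrow>\<^sub>0 'k"
    by (simp add: mul_tensor aug_mult)
  show "aug (1 :: 'm \<Rightarrow>\<^sub>0 'k) = 1" by (rule aug_1)
  show "free.subspace (homogeneous d n :: ('m \<Rightarrow>\<^sub>0 'k) set)" for n by (rule subspace_homogeneous)
  show "\<exists>!c. (\<forall>n. c n \<in> homogeneous d n) \<and> finite {n. c n \<noteq> 0} \<and> x = (\<Sum>n | c n \<noteq> 0. c n)"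
    for x :: "'m \<Rightarrow>\<^sub>0 'k"
    by (rule homogeneous_direct_sum)
  show "mul (tensor x y) \<in> homogeneous d (m + n)"
    if "x \<in> homogeneous d m" "y \<in> homogeneous d n" for x y :: "'m \<Rightarrow>\<^sub>0 'k" and m n
    using that by (simp add: mul_tensor mult_homogeneous[OF d_add])
  show "(1 :: 'm \<Rightarrow>\<^sub>0 'k) \<in> homogeneous d 0"
    by (simp add: basis_0[symmetric] basis_homogeneous d_0)
  show "comult x \<in> free.span {tensor y z | y z i j.
      y \<in> homogeneous d i \<and> z \<in> homogeneous d j \<and> i + j = n}"
    if "x \<in> homogeneous d n" for x :: "'m \<Rightarrow>\<^sub>0 'k" and n
    by (rule homogeneous_tensor_span[OF comult_homogeneous[OF that]])
  show "aug x = 0" if "x \<in> homogeneous d n" "n \<noteq> 0" for x :: "'m \<Rightarrow>\<^sub>0 'k" and n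
    using that d_0 unfolding aug_def lin_ext_def
    by (intro sum.neutral) (auto simp: homogeneous_def)
  show "\<exists>S. lin S \<and>
      (\<forall>x. mul (tensor_map S id (comult x)) = scale (aug x) (1 :: 'm \<Rightarrow>\<^sub>0 'k)) \<and>
      (\<forall>x. mul (tensor_map id S (comult x)) = scale (aug x) 1) \<and>
      (\<forall>n. S ` homogeneous d n \<subseteq> homogeneous d n)"
    using alg_hom_lin[OF alg_hom_antipode] antipode_comult antipode_homogeneous by blast
  show "free.dim (homogeneous d 0 :: ('m \<Rightarrow>\<^sub>0 'k) set) = 1" by (rule dim_homogeneous_0)
qed

text \<open>The product runs over positions, not over elements, so that repeated factors stay
  distinct when it is expanded over subsets.\<close>

lemma comult_sum_list:
  assumes "\<And>g. g \<in> set gs \<Longrightarrow> factors g = {#g#}"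
  shows "comult (basis (sum_list gs)) =
    (\<Prod>i<length gs. basis (gs ! i, 0) + basis (0, gs ! i))"
proof -
  have "comult (basis (sum_list gs)) = (\<Prod>g\<leftarrow>gs. basis (g, 0) + basis (0, g))"
    using assms
    by (induction gs)
      (simp_all add: basis_0 basis_add alg_hom_1[OF alg_hom_comult] alg_hom_mult[OF alg_hom_comult]
        comult_prime)
  then show ?thesis by (simp add: prod.list_conv_set_nth atLeast0LessThan)
qed

end


section \<open>The commutative monoid of orbits\<close>

lemma empty_partitions: "{} \<in> partitions 0"
  by (simp add: partitions_def ground_def partition_on_def)

lemma partitions_0: "p \<in> partitions 0 \<Longrightarrow> p = {}"
  by (auto simp: partitions_def ground_def partition_on_def)

lemma relabel_id: "relabel id p = p"
  by (simp add: relabel_def label.map_id0)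

lemma relabel_empty: "relabel f {} = {}"
  by (simp add: relabel_def)

lemma relabel_Un: "relabel f (p \<union> q) = relabel f p \<union> relabel f q"
  by (simp add: relabel_def image_Un)

lemma orb_cases:
  obtains k p where "p \<in> partitions k" "P = orb p"
proof -
  have "Rep_diagram_orbit P \<in> {orbit_set k p | k p. p \<in> partitions k}"
    by (rule Rep_diagram_orbit)
  then obtain k p where "p \<in> partitions k" "Rep_diagram_orbit P = orbit_set k p" by blast
  moreover from this have "P = orb p"
    by (metis Rep_diagram_orbit_inverse deg_eq orb_def)
  ultimately show ?thesis using that by blast
qed

lemma relabel_image_atLeastAtMost:
  assumes "p \<in> partitions k" "relabel f p \<in> partitions l"
  shows "f ` {1..k} = {1..l}"
proof -
  have "map_label f ` \<Union>p = \<Union>(relabel f p)" by (auto simp: relabel_def)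
  then have "map_label f ` ground k = ground l"
    using assms by (simp add: partitions_def partition_on_def)
  then have "Unprimed ` (f ` {1..k}) \<union> Primed ` (f ` {1..k}) = Unprimed ` {1..l} \<union> Primed ` {1..l}"
    by (simp only: map_label_ground) (simp add: ground_def)
  then show ?thesis by blast
qed

text \<open>A map of \<open>{1..k}\<close> onto itself is a bijection by finiteness, and changing it
  to the identity elsewhere yields a permutation. Hence piecewise formulas can serve as relabellings
  whatever they do outside \<open>{1..k}\<close>.\<close>

lemma orb_relabel_eq:
  assumes p: "p \<in> partitions k" and q: "relabel f p \<in> partitions k"
  shows "orb (relabel f p) = orb p"
proof -
  have f: "f ` {1..k} = {1..k}" by (rule relabel_image_atLeastAtMost[OF p q])
  then have "bij_betw f {1..k} {1..k}"
    by (simp add: bij_betw_def eq_card_imp_inj_on)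
  then have "bij_betw (\<lambda>i. if i \<in> {1..k} then f i else i) {1..k} {1..k}"
    by (rule bij_betw_cong[THEN iffD1, rotated]) simp
  then have "(\<lambda>i. if i \<in> {1..k} then f i else i) permutes {1..k}"
    by (rule bij_imp_permutes) auto
  moreover have "relabel (\<lambda>i. if i \<in> {1..k} then f i else i) p = relabel f p"
    by (rule relabel_cong[OF p]) simp
  ultimately show ?thesis using orb_relabel[OF p] by metis
qed

lemma juxtapose_empty_left: "{} \<otimes>\<^sub>P p = p"
  by (simp add: juxtapose_def deg_eq[OF empty_partitions] relabel_id[unfolded id_def])

lemma juxtapose_empty_right: "p \<otimes>\<^sub>P {} = p"
  by (simp add: juxtapose_def relabel_empty)

text \<open>Holds for the diagrams themselves, since successive shifts add up; only commutativity
  requires passing to orbits.\<close>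

lemma juxtapose_assoc:
  assumes "p \<in> partitions k" "q \<in> partitions l"
  shows "(p \<otimes>\<^sub>P q) \<otimes>\<^sub>P r = p \<otimes>\<^sub>P (q \<otimes>\<^sub>P r)"
proof -
  have "(+) k \<circ> (+) l = (+) (k + l)" by auto
  then show ?thesis
    by (simp add: juxtapose_def deg_eq[OF juxtapose_partitions[OF assms], unfolded juxtapose_def deg_eq[OF assms(1)]]
      deg_eq[OF assms(1)] deg_eq[OF assms(2)] relabel_Un relabel_comp Un_assoc)
qed

lemma orb_juxtapose_commute:
  assumes p: "p \<in> partitions k" and q: "q \<in> partitions l"
  shows "orb (p \<otimes>\<^sub>P q) = orb (q \<otimes>\<^sub>P p)"
proof -
  \<comment> \<open>The block transposition: the first \<open>k\<close> labels move behind the last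
    \<open>l\<close>. Its values outside \<open>{1..k + l}\<close> do not matter.\<close>
  define f where "f i = (if i \<le> k then l + i else i - k)" for i
  have "relabel f p = relabel ((+) l) p"
    by (rule relabel_cong[OF p]) (simp add: f_def)
  moreover have "relabel (f \<circ> (+) k) q = relabel id q"
    by (rule relabel_cong[OF q]) (simp add: f_def)
  ultimately have *: "relabel f (p \<otimes>\<^sub>P q) = q \<otimes>\<^sub>P p"
    by (simp add: juxtapose_def deg_eq[OF p] deg_eq[OF q] relabel_Un relabel_comp relabel_id Un_commute)
  show ?thesis
    using orb_relabel_eq[OF juxtapose_partitions[OF p q], of f] juxtapose_partitions[OF q p]
    by (simp add: * add.commute)
qed

instantiation diagram_orbit :: comm_monoid_add
begin

definition zero_diagram_orbit :: diagram_orbit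
  where "0 = orb {}"

definition plus_diagram_orbit :: "diagram_orbit \<Rightarrow> diagram_orbit \<Rightarrow> diagram_orbit"
  where "P + Q = orbit_mult P Q"

instance
proof
  fix P Q R :: diagram_orbit
  obtain k p where p: "p \<in> partitions k" "P = orb p" by (rule orb_cases)
  obtain l q where q: "q \<in> partitions l" "Q = orb q" by (rule orb_cases)
  obtain m r where r: "r \<in> partitions m" "R = orb r" by (rule orb_cases)
  note [simp] = plus_diagram_orbit_def zero_diagram_orbit_def p q r orbit_mult_orb[OF p(1) q(1)]
    orbit_mult_orb[OF q(1) r(1)] orbit_mult_orb[OF q(1) p(1)]
    orbit_mult_orb[OF juxtapose_partitions[OF p(1) q(1)] r(1)]
    orbit_mult_orb[OF p(1) juxtapose_partitions[OF q(1) r(1)]]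
    orbit_mult_orb[OF empty_partitions p(1)]
  show "P + Q + R = P + (Q + R)"
    by (simp add: juxtapose_assoc[OF p(1) q(1)])
  show "P + Q = Q + P"
    by (simp add: orb_juxtapose_commute[OF p(1) q(1)])
  show "0 + P = P"
    by (simp add: juxtapose_empty_left)
qed

end

lemma orb_empty: "orb {} = 0"
  by (simp add: zero_diagram_orbit_def)

lemma orb_juxtapose:
  "p \<in> partitions k \<Longrightarrow> q \<in> partitions l \<Longrightarrow> orb (p \<otimes>\<^sub>P q) = orb p + orb q"
  by (simp add: plus_diagram_orbit_def orbit_mult_orb)

lemma juxtapose_list_simps [simp]:
  "juxtapose_list [] = {}" "juxtapose_list (p # ps) = p \<otimes>\<^sub>P juxtapose_list ps"
  by (simp_all add: juxtapose_list_def)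

lemma juxtapose_list_partitions:
  assumes "\<And>p. p \<in> set ps \<Longrightarrow> \<exists>k. p \<in> partitions k"
  shows "\<exists>k. juxtapose_list ps \<in> partitions k"
  using assms
proof (induction ps)
  case Nil
  then show ?case using empty_partitions by auto
next
  case (Cons p ps)
  then obtain k l where "p \<in> partitions k" "juxtapose_list ps \<in> partitions l"
    by (meson list.set_intros)
  then have "p \<otimes>\<^sub>P juxtapose_list ps \<in> partitions (k + l)" by (rule juxtapose_partitions)
  then show ?case by auto
qed

lemma orb_juxtapose_list:
  assumes "\<And>p. p \<in> set ps \<Longrightarrow> \<exists>k. p \<in> partitions k"
  shows "orb (juxtapose_list ps) = sum_list (map orb ps)"
  using assms
proof (induction ps)
  case Nil
  then show ?case by (simp add: orb_empty)
next
  case (Cons p ps)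
  obtain k l where "p \<in> partitions k" "juxtapose_list ps \<in> partitions l"
    using Cons.prems juxtapose_list_partitions[of ps] by (meson list.set_intros)
  then show ?case using Cons by (simp add: orb_juxtapose)
qed

definition orbit_deg :: "diagram_orbit \<Rightarrow> nat"
  where "orbit_deg P = (THE k. P \<in> orbits k)"

lemma orb_in_orbits: "p \<in> partitions k \<Longrightarrow> orb p \<in> orbits l \<longleftrightarrow> k = l"
  using orb_eqD(1) by (auto simp: orbits_def)

lemma orbit_deg_orb: "p \<in> partitions k \<Longrightarrow> orbit_deg (orb p) = k"
  unfolding orbit_deg_def by (rule the_equality) (simp_all add: orb_in_orbits)

lemma orbits_eq: "orbits k = {P. orbit_deg P = k}"
proof (intro set_eqI iffI)
  fix P
  obtain l p where "p \<in> partitions l" "P = orb p" by (rule orb_cases)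
  then show "P \<in> orbits k \<Longrightarrow> P \<in> {P. orbit_deg P = k}" "P \<in> {P. orbit_deg P = k} \<Longrightarrow> P \<in> orbits k"
    by (auto simp: orb_in_orbits orbit_deg_orb)
qed

lemma orbit_deg_add: "orbit_deg (P + Q) = orbit_deg P + orbit_deg Q"
proof -
  obtain k p where p: "p \<in> partitions k" "P = orb p" by (rule orb_cases)
  obtain l q where q: "q \<in> partitions l" "Q = orb q" by (rule orb_cases)
  show ?thesis
    using orbit_deg_orb[OF juxtapose_partitions[OF p(1) q(1)]]
    by (simp add: p q orb_juxtapose[OF p(1) q(1)] orbit_deg_orb[OF p(1)] orbit_deg_orb[OF q(1)])
qed

lemma orbit_deg_eq_0: "orbit_deg P = 0 \<Longrightarrow> P = 0"
  by (rule orb_cases[of P]) (auto simp: orbit_deg_orb orb_empty dest: partitions_0)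


section \<open>Connected components of a diagram\<close>

primrec index :: "'a label \<Rightarrow> 'a"
  where "index (Unprimed i) = i" | "index (Primed i) = i"

lemma index_map_label: "index (map_label f x) = f (index x)"
  by (cases x) simp_all

lemma index_image_relabel: "index ` (map_label f ` X) = f ` index ` X"
  by (simp add: image_image index_map_label)

lemma map_label_eq_iff: "map_label f x = map_label f y \<longleftrightarrow> x = y"
  if "f (index x) = f (index y) \<Longrightarrow> index x = index y"
  using that by (cases x; cases y) auto

lemma map_label_vimage_index: "map_label f ` (index -` D) = index -` (f ` D)"
proof
  show "index -` (f ` D) \<subseteq> map_label f ` (index -` D)"
  proof
    fix x assume "x \<in> index -` (f ` D)"
    then obtain i where "i \<in> D" "index x = f i" by auto
    then have "x = map_label f (Unprimed i) \<or> x = map_label f (Primed i)" by (cases x) auto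
    moreover have "Unprimed i \<in> index -` D" "Primed i \<in> index -` D"
      using \<open>i \<in> D\<close> by simp_all
    ultimately show "x \<in> map_label f ` (index -` D)" by blast
  qed
qed (auto simp: index_map_label)

lemma ground_eq: "ground k = index -` {1..k}"
proof (rule set_eqI)
  show "x \<in> ground k \<longleftrightarrow> x \<in> index -` {1..k}" for x :: "nat label"
    by (cases x) (auto simp: ground_def)
qed

text \<open>Unlike \<open>relabel_partition_on\<close>, this allows any index set and asks for
  injectivity only there, as needed for renumbering the pieces of a split diagram.\<close>

lemma partition_on_relabel:
  assumes "partition_on (index -` D) p" "inj_on f D"
  shows "partition_on (index -` (f ` D)) (relabel f p)"
proof -
  have "inj_on (map_label f) (index -` D)"
  proof (rule inj_onI)
    fix x y assume "x \<in> index -` D" "y \<in> index -` D" "map_label f x = map_label f y"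
    then show "x = y" using assms(2) map_label_eq_iff[of f x y] by (auto dest: inj_onD)
  qed
  moreover have "relabel f p - {{}} = relabel f p"
    using assms(1) by (auto simp: relabel_def partition_on_def)
  ultimately show ?thesis
    using partition_on_inj_image[OF assms(1), of "map_label f"]
    by (simp add: relabel_def map_label_vimage_index)
qed

text \<open>
  Joining \<open>p\<close> with \<open>id\<^sub>k\<close> merges the blocks that share an index. So the unions of blocks of
  \<open>p \<or> id\<^sub>k\<close> correspond to the saturated subsets of \<open>p\<close>.
\<close>

definition saturated :: "diagram \<Rightarrow> diagram \<Rightarrow> bool"
  where "saturated p c \<longleftrightarrow> c \<subseteq> p \<and> (\<forall>X\<in>c. \<forall>Y\<in>p. index ` X \<inter> index ` Y \<noteq> {} \<longrightarrow> Y \<in> c)"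

text \<open>Saturation is tested inside \<open>c\<close>, not inside an ambient diagram. The notion
  is therefore intrinsic and can be matched with irreducibility of \<open>c\<close>.\<close>

definition connected_diagram :: "diagram \<Rightarrow> bool"
  where "connected_diagram c \<longleftrightarrow> c \<noteq> {} \<and> (\<forall>d. saturated c d \<longrightarrow> d = {} \<or> d = c)"

definition components :: "diagram \<Rightarrow> diagram set"
  where "components p = {c. saturated p c \<and> connected_diagram c}"

lemma saturated_diff: "saturated p c \<Longrightarrow> saturated p (p - c)"
  unfolding saturated_def by (metis Diff_iff Diff_subset Int_commute)

lemma inj_relabel: "inj f \<Longrightarrow> inj (relabel f)"
  unfolding relabel_def by (intro injI) (metis inj_image_eq_iff injI label.inj_map)

lemma saturated_relabel:
  assumes "inj f"
  shows "saturated (relabel f p) (relabel f c) \<longleftrightarrow> saturated p c"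
proof -
  have g: "inj ((`) (map_label f))"
    by (rule injI) (metis assms inj_image_eq_iff label.inj_map)
  have "index ` map_label f ` X \<inter> index ` map_label f ` Y = {} \<longleftrightarrow> index ` X \<inter> index ` Y = {}" for X Y
    by (simp only: index_image_relabel image_Int[OF assms, symmetric] image_is_empty)
  then show ?thesis
    unfolding saturated_def relabel_def
    by (simp add: inj_image_subset_iff[OF g] inj_image_mem_iff[OF g])
qed

lemma subset_relabel: "d \<subseteq> relabel f p \<longleftrightarrow> (\<exists>c\<subseteq>p. d = relabel f c)"
  unfolding relabel_def by (rule subset_image_iff)

lemma connected_relabel:
  assumes "inj f"
  shows "connected_diagram (relabel f c) \<longleftrightarrow> connected_diagram c"
proof -
  have eq: "relabel f d = relabel f e \<longleftrightarrow> d = e" for d e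
    using inj_relabel[OF assms] by (simp add: inj_eq)
  have e: "relabel f d = {} \<longleftrightarrow> d = {}" for d by (simp add: relabel_def)
  have "(\<forall>d. saturated (relabel f c) d \<longrightarrow> d = {} \<or> d = relabel f c) \<longleftrightarrow>
      (\<forall>d. saturated (relabel f c) (relabel f d) \<longrightarrow> relabel f d = {} \<or> relabel f d = relabel f c)"
    using subset_relabel[of _ f c] by (metis saturated_def)
  then show ?thesis
    unfolding connected_diagram_def by (simp add: saturated_relabel[OF assms] eq e)
qed

lemma components_relabel:
  assumes "inj f"
  shows "components (relabel f p) = relabel f ` components p"
proof
  show "relabel f ` components p \<subseteq> components (relabel f p)"
    by (auto simp: components_def saturated_relabel[OF assms] connected_relabel[OF assms])
  show "components (relabel f p) \<subseteq> relabel f ` components p"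
  proof
    fix d assume d: "d \<in> components (relabel f p)"
    then obtain c where "d = relabel f c"
      using subset_relabel[of d f p] by (auto simp: components_def saturated_def)
    then show "d \<in> relabel f ` components p"
      using d by (auto simp: components_def saturated_relabel[OF assms] connected_relabel[OF assms])
  qed
qed

lemma saturated_Un:
  assumes "c \<subseteq> p" and disj: "\<And>X Y. X \<in> p \<Longrightarrow> Y \<in> q \<Longrightarrow> index ` X \<inter> index ` Y = {}"
  shows "saturated (p \<union> q) c \<longleftrightarrow> saturated p c"
proof -
  have "(\<forall>Y\<in>p \<union> q. index ` X \<inter> index ` Y \<noteq> {} \<longrightarrow> Y \<in> c) \<longleftrightarrow>
      (\<forall>Y\<in>p. index ` X \<inter> index ` Y \<noteq> {} \<longrightarrow> Y \<in> c)" if "X \<in> c" for X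
    using disj[of X] that assms(1) by (simp add: ball_Un subset_iff)
  then show ?thesis
    using assms(1) by (simp add: saturated_def le_supI1)
qed

lemma components_Un:
  assumes disj: "\<And>X Y. X \<in> p \<Longrightarrow> Y \<in> q \<Longrightarrow> index ` X \<inter> index ` Y = {}"
  shows "components (p \<union> q) = components p \<union> components q"
proof (rule set_eqI)
  fix c
  have "c \<subseteq> p \<or> c \<subseteq> q" if "connected_diagram c" "c \<subseteq> p \<union> q"
  proof -
    \<comment> \<open>No block of \<open>p\<close> is linked to a block of \<open>q\<close>, so the
      part of \<open>c\<close> on either side is saturated and a connected \<open>c\<close> lies on
      one side.\<close>
    have "saturated c (c \<inter> p)"
      using that(2) disj unfolding saturated_def by blast
    then have "c \<inter> p = {} \<or> c \<inter> p = c" using that(1) unfolding connected_diagram_def by blast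
    then show ?thesis using that(2) by blast
  qed
  moreover have "saturated (p \<union> q) c \<longleftrightarrow> saturated p c" if "c \<subseteq> p"
    by (rule saturated_Un[OF that disj])
  moreover have "saturated (q \<union> p) c \<longleftrightarrow> saturated q c" if "c \<subseteq> q"
    by (rule saturated_Un[OF that]) (use disj Int_commute in metis)
  then have "saturated (p \<union> q) c \<longleftrightarrow> saturated q c" if "c \<subseteq> q"
    using that by (simp add: Un_commute)
  moreover have "c \<subseteq> r" if "saturated r c" for r
    using that by (simp add: saturated_def)
  ultimately show "c \<in> components (p \<union> q) \<longleftrightarrow> c \<in> components p \<union> components q"
    unfolding components_def by blast
qed

text \<open>Disjoint index sets alone would still allow the empty block in both diagrams, hence the
  second hypothesis.\<close>

lemma components_disjoint:
  assumes "\<And>X Y. X \<in> p \<Longrightarrow> Y \<in> q \<Longrightarrow> index ` X \<inter> index ` Y = {}" "{} \<notin> p"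
  shows "components p \<inter> components q = {}"
proof -
  have False if c: "c \<in> components p" "c \<in> components q" for c
  proof -
    have "c \<noteq> {}" "c \<subseteq> p" "c \<subseteq> q"
      using c by (auto simp: components_def saturated_def connected_diagram_def)
    then obtain X where "X \<in> p" "X \<in> q" by blast
    then show False using assms by (metis Int_absorb image_is_empty)
  qed
  then show ?thesis by blast
qed

lemma components_empty: "components {} = {}"
  by (auto simp: components_def saturated_def connected_diagram_def)

lemma components_connected: "connected_diagram p \<Longrightarrow> components p = {p}"
  unfolding components_def connected_diagram_def saturated_def by blast

lemma finite_components:
  assumes "p \<in> partitions k"
  shows "finite (components p)"
proof -
  have "finite (ground k)" by (simp add: ground_def)
  then have "finite p"
    using assms finite_elements unfolding partitions_def by blast
  then show ?thesis
    by (rule finite_subset[OF _ finite_Pow_iff[THEN iffD2], rotated])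
      (auto simp: components_def saturated_def)
qed

section \<open>Irreducibility as connectedness under shared indices\<close>

lemma id_partition_partitions: "id_partition k \<in> partitions k"
  unfolding partitions_def mem_Collect_eq
  by (rule partition_onI) (auto simp: id_partition_def ground_def disjnt_def)

text \<open>A proper nonempty saturated \<open>d\<close> would give a two-block partition coarser
  than both \<open>p\<close> and the identity, hence coarser than their join, which consists of a
  single block.\<close>

lemma connected_if_irreducible:
  assumes p: "p \<in> partitions k" and irr: "card (partition_join (ground k) p (id_partition k)) = 1"
  shows "connected_diagram p"
  unfolding connected_diagram_def
proof (intro conjI allI impI)
  define J where "J = partition_join (ground k) p (id_partition k)"
  have P: "partition_on (ground k) p" using p by (simp add: partitions_def)
  have Q: "partition_on (ground k) (id_partition k)"
    using id_partition_partitions by (simp add: partitions_def)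
  note J = partition_join[OF P Q, folded J_def]
  obtain Y where Y: "J = {Y}" using irr unfolding J_def by (auto simp: card_1_singleton_iff)
  have "partition_on (ground k) J" using J(1) by (simp add: refines_def)
  then have Yg: "Y = ground k" "ground k \<noteq> {}" by (auto simp: Y partition_on_def)
  then show "p \<noteq> {}" using P by (auto simp: partition_on_def)
  fix d assume d: "saturated p d"
  have pd: "d \<subseteq> p" using d by (simp add: saturated_def)
  show "d = {} \<or> d = p"
  proof (rule ccontr)
    assume *: "\<not> (d = {} \<or> d = p)"
    define s where "s = {\<Union>d, \<Union>(p - d)}"
    have blocks: "X \<noteq> {}" if "X \<in> p" for X using P that by (auto simp: partition_on_def)
    have "d \<noteq> {}" "p - d \<noteq> {}" using * pd by auto
    then obtain X X' where "X \<in> d" "X' \<in> p - d" by blast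
    then have "X \<noteq> {}" "X' \<noteq> {}" "X \<subseteq> \<Union>d" "X' \<subseteq> \<Union>(p - d)" using blocks pd by auto
    then have ne: "\<Union>d \<noteq> {}" "\<Union>(p - d) \<noteq> {}" by (metis subset_empty)+
    have dn: "disjnt (\<Union>d) (\<Union>(p - d))"
    proof -
      have "X \<inter> Z = {}" if "X \<in> d" "Z \<in> p - d" for X Z
      proof -
        have "X \<in> p" "Z \<in> p" "X \<noteq> Z" using that pd by auto
        then show ?thesis using partition_onD2[OF P] by (simp add: disjoint_def)
      qed
      then show ?thesis unfolding disjnt_def by blast
    qed
    have S: "partition_on (ground k) s"
    proof (rule partition_onI)
      have "\<Union>s = \<Union>(d \<union> (p - d))" by (simp only: s_def Union_insert Union_empty Union_Un_distrib Un_empty_right)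
      also have "d \<union> (p - d) = p" using pd by blast
      finally show "\<Union>s = ground k" using P by (simp add: partition_on_def)
      show "disjnt X Z" if "X \<in> s" "Z \<in> s" "X \<noteq> Z" for X Z
        using that dn by (auto simp: s_def disjnt_sym)
      show "{} \<notin> s"
        using ne unfolding s_def by (metis insertE singletonD)
    qed
    have "refines (ground k) p s"
      unfolding refines_def using P S by (auto simp: s_def)
    moreover have "refines (ground k) (id_partition k) s"
      unfolding refines_def
    proof (intro conjI ballI Q S)
      fix X assume "X \<in> id_partition k"
      then obtain i where i: "i \<in> {1..k}" "X = {Unprimed i, Primed i}"
        by (auto simp: id_partition_def)
      then have "Unprimed i \<in> \<Union>p" "Primed i \<in> \<Union>p"
        using P by (auto simp: partition_on_def ground_def)
      then obtain A B where AB: "A \<in> p" "B \<in> p" "Unprimed i \<in> A" "Primed i \<in> B" by auto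
      then have "i \<in> index ` A" "i \<in> index ` B" by force+
      then have "index ` A \<inter> index ` B \<noteq> {}" "index ` B \<inter> index ` A \<noteq> {}" by blast+
      \<comment> \<open>The blocks containing \<open>i\<close> and its primed copy share the index
        \<open>i\<close>, so saturation puts both on the same side of the split.\<close>
      then have "A \<in> d \<longleftrightarrow> B \<in> d"
        using d AB(1,2) unfolding saturated_def by metis
      then show "\<exists>Y\<in>s. X \<subseteq> Y" using AB by (auto simp: s_def i)
    qed
    ultimately have "refines (ground k) J s" by (rule J(3))
    then obtain Z where "Z \<in> s" "ground k \<subseteq> Z" by (auto simp: refines_def Y Yg)
    moreover have "\<Union>d \<subseteq> ground k" "\<Union>(p - d) \<subseteq> ground k"
      using P pd by (auto simp: partition_on_def)
    moreover have False if "Z = A \<or> Z = B" "G \<subseteq> Z" "A \<subseteq> G" "B \<subseteq> G" "A \<inter> B = {}" "A \<noteq> {}" "B \<noteq> {}"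
      for A B G :: "nat label set"
      using that by blast
    ultimately show False using dn ne unfolding s_def disjnt_def by (metis insertE singletonD)
  qed
qed

text \<open>The blocks of \<open>p\<close> inside one block \<open>Y\<close> of the join form a
  nonempty saturated set. By connectedness this is all of \<open>p\<close>, so \<open>Y\<close> is
  the whole ground set.\<close>

lemma irreducible_if_connected:
  assumes p: "p \<in> partitions k" and con: "connected_diagram p"
  shows "card (partition_join (ground k) p (id_partition k)) = 1"
proof -
  define J where "J = partition_join (ground k) p (id_partition k)"
  have P: "partition_on (ground k) p" using p by (simp add: partitions_def)
  have Q: "partition_on (ground k) (id_partition k)"
    using id_partition_partitions by (simp add: partitions_def)
  note J = partition_join[OF P Q, folded J_def]
  have JP: "partition_on (ground k) J" using J(1) by (simp add: refines_def)
  have same: "Y = Y'" if "Y \<in> J" "Y' \<in> J" "x \<in> Y" "x \<in> Y'" for x Y Y'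
    using partition_onD2[OF JP] that unfolding disjoint_def by blast
  have all: "Y = ground k" if Y: "Y \<in> J" for Y
  proof -
    define d where "d = {X \<in> p. X \<subseteq> Y}"
    have blk: "\<exists>Z\<in>J. X \<subseteq> Z" if "X \<in> p" for X using J(1) that by (auto simp: refines_def)
    have "saturated p d"
      unfolding saturated_def
    proof (intro conjI ballI impI)
      show "d \<subseteq> p" by (auto simp: d_def)
      fix X X' assume X: "X \<in> d" "X' \<in> p" "index ` X \<inter> index ` X' \<noteq> {}"
      then obtain x x' where x: "x \<in> X" "x' \<in> X'" "index x = index x'" by auto
      have "x \<in> ground k" using X x P by (auto simp: d_def partition_on_def)
      then have "{Unprimed (index x), Primed (index x)} \<in> id_partition k"
        by (auto simp: ground_eq id_partition_def)
      then obtain Z where Z: "Z \<in> J" "{Unprimed (index x), Primed (index x)} \<subseteq> Z"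
        using J(2) by (auto simp: refines_def)
      then have xZ: "x \<in> Z" "x' \<in> Z" using x(3) by (cases x; cases x'; simp)+
      have "x \<in> Y" using X(1) x(1) by (auto simp: d_def)
      then have "Z = Y" by (rule same[OF Z(1) Y xZ(1)])
      obtain Z' where Z': "Z' \<in> J" "X' \<subseteq> Z'" using blk X by blast
      then have "x' \<in> Z'" using x(2) by blast
      then have "Z' = Z" by (rule same[OF Z'(1) Z(1) _ xZ(2)])
      then show "X' \<in> d" using Z'(2) X(2) \<open>Z = Y\<close> by (simp add: d_def)
    qed
    moreover have "d \<noteq> {}"
    proof -
      have "Y \<noteq> {}" using JP Y by (auto simp: partition_on_def)
      then obtain y where y: "y \<in> Y" by blast
      then have "y \<in> \<Union>p" using JP P Y by (auto simp: partition_on_def)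
      then obtain X where X: "X \<in> p" "y \<in> X" by auto
      then obtain Z where Z: "Z \<in> J" "X \<subseteq> Z" using blk by blast
      then have "y \<in> Z" using X(2) by blast
      then have "Z = Y" using same[OF Z(1) Y _ y] by simp
      then have "X \<in> d" using X(1) Z(2) by (simp add: d_def)
      then show ?thesis by blast
    qed
    ultimately have "d = p" using con by (auto simp: connected_diagram_def)
    then have "ground k \<subseteq> Y" using P by (auto simp: d_def partition_on_def)
    then show ?thesis using JP Y by (auto simp: partition_on_def)
  qed
  moreover have "J \<noteq> {}"
  proof -
    obtain X where "X \<in> p" using con by (auto simp: connected_diagram_def)
    then show ?thesis using J(1) by (auto simp: refines_def)
  qed
  ultimately have "J = {ground k}" by blast
  then show ?thesis by (simp add: J_def)
qed

lemma irreducible_iff_connected: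
  "p \<in> partitions k \<Longrightarrow> irreducible_diagram p \<longleftrightarrow> connected_diagram p"
  using connected_if_irreducible irreducible_if_connected
  unfolding irreducible_diagram_def by blast

lemma irreducible_partitions: "irreducible_diagram p \<Longrightarrow> \<exists>k. p \<in> partitions k"
  by (auto simp: irreducible_diagram_def)


section \<open>Unique factorisation into irreducible orbits\<close>

text \<open>Components live on arbitrary index sets, so they cannot be compared through
  \<open>orb\<close>. Asking for relabellings in both directions, with no injectivity, makes
  symmetry and transitivity immediate; \<open>diagram_iso_iff_orb\<close> shows that nothing is lost
  on genuine partitions.\<close>

definition diagram_iso :: "diagram \<Rightarrow> diagram \<Rightarrow> bool"
  where "diagram_iso q c \<longleftrightarrow> (\<exists>f g. c = relabel f q \<and> q = relabel g c)"

lemma relabel_inv: "inj f \<Longrightarrow> relabel (inv f) (relabel f p) = p"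
  by (simp add: relabel_comp inv_o_cancel relabel_id)

lemma diagram_iso_trans: "diagram_iso p q \<Longrightarrow> diagram_iso q r \<Longrightarrow> diagram_iso p r"
  unfolding diagram_iso_def by (metis relabel_comp)

lemma diagram_iso_sym: "diagram_iso p q \<Longrightarrow> diagram_iso q p"
  unfolding diagram_iso_def by blast

lemma diagram_iso_relabel: "inj f \<Longrightarrow> diagram_iso c (relabel f c)"
  unfolding diagram_iso_def by (metis relabel_inv)

lemma diagram_iso_relabel_iff: "inj f \<Longrightarrow> diagram_iso q (relabel f c) \<longleftrightarrow> diagram_iso q c"
  using diagram_iso_relabel diagram_iso_sym diagram_iso_trans by blast

text \<open>The two relabellings map \<open>{1..k}\<close> onto \<open>{1..l}\<close> and back, so
  counting forces \<open>k = l\<close>, after which \<open>orb_relabel_eq\<close> applies.\<close>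

lemma diagram_iso_iff_orb:
  assumes p: "p \<in> partitions k" and q: "q \<in> partitions l"
  shows "diagram_iso p q \<longleftrightarrow> orb p = orb q"
proof
  assume "diagram_iso p q"
  then obtain f g where fg: "q = relabel f p" "p = relabel g q" unfolding diagram_iso_def by blast
  have rel: "relabel f p \<in> partitions l" "relabel g q \<in> partitions k"
    using p q by (simp_all only: fg[symmetric])
  have "f ` {1..k} = {1..l}" "g ` {1..l} = {1..k}"
    by (rule relabel_image_atLeastAtMost[OF p rel(1)], rule relabel_image_atLeastAtMost[OF q rel(2)])
  then have "card {1..l} \<le> card {1..k}" "card {1..k} \<le> card {1..l}"
    by (metis card_image_le finite_atLeastAtMost)+
  then have "k = l" by simp
  then show "orb p = orb q" using orb_relabel_eq[OF p, of f] rel(1) by (simp only: fg(1)[symmetric])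
next
  assume "orb p = orb q"
  then obtain \<sigma> where "\<sigma> permutes {1..k}" "q = relabel \<sigma> p" using orb_eqD(2)[OF p q] by blast
  then show "diagram_iso p q" using diagram_iso_relabel permutes_inj by blast
qed

definition component_count :: "diagram \<Rightarrow> diagram \<Rightarrow> nat"
  where "component_count q p = card {c \<in> components p. diagram_iso q c}"

lemma component_count_relabel:
  assumes "inj f"
  shows "component_count q (relabel f p) = component_count q p"
proof -
  have "{c \<in> components (relabel f p). diagram_iso q c} =
      relabel f ` {c \<in> components p. diagram_iso q c}"
    by (auto simp: components_relabel[OF assms] diagram_iso_relabel_iff[OF assms])
  then show ?thesis
    unfolding component_count_def
    using card_image[OF inj_on_subset[OF inj_relabel[OF assms]]] by simp
qed

lemma component_count_orb:
  assumes p: "p \<in> partitions k" and p': "p' \<in> partitions k'" and eq: "orb p = orb p'"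
  shows "component_count q p = component_count q p'"
proof -
  obtain \<sigma> where "\<sigma> permutes {1..k}" "p' = relabel \<sigma> p" using orb_eqD(2)[OF p p' eq] by blast
  then show ?thesis using component_count_relabel permutes_inj by metis
qed

text \<open>The shift by \<open>k\<close> separates the index ranges, so no block on the left is
  linked to one on the right and the components are those of the two parts.\<close>

lemma component_count_juxtapose:
  assumes p: "p \<in> partitions k" and p': "p' \<in> partitions l"
  shows "component_count q (p \<otimes>\<^sub>P p') = component_count q p + component_count q p'"
proof -
  let ?r = "relabel ((+) k) p'"
  have inj: "inj ((+) k)" by simp
  have disj: "index ` X \<inter> index ` Y = {}" if XY: "X \<in> p" "Y \<in> ?r" for X Y
  proof -
    have "X \<subseteq> ground k" using p XY by (auto simp: partitions_def partition_on_def)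
    then have X: "index ` X \<subseteq> {1..k}" by (auto simp: ground_eq)
    obtain Z where Z: "Z \<in> p'" "Y = map_label ((+) k) ` Z" using XY by (auto simp: relabel_def)
    then have "Z \<subseteq> ground l" using p' by (auto simp: partitions_def partition_on_def)
    then have "index ` Z \<subseteq> {1..l}" by (auto simp: ground_eq)
    then have "index ` Y \<subseteq> (+) k ` {1..l}"
      unfolding Z(2) index_image_relabel by (rule image_mono)
    moreover have "{1..k} \<inter> (+) k ` {1..l} = {}" by auto
    ultimately show ?thesis using X by blast
  qed
  have "{} \<notin> p" using p by (auto simp: partitions_def partition_on_def)
  note parts = components_Un[OF disj] components_disjoint[OF disj this]
  have "p \<otimes>\<^sub>P p' = p \<union> ?r" by (simp add: juxtapose_def deg_eq[OF p])
  moreover have "component_count q (p \<union> ?r) = component_count q p + component_count q ?r"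
  proof -
    have "{c \<in> components (p \<union> ?r). diagram_iso q c} =
        {c \<in> components p. diagram_iso q c} \<union> {c \<in> components ?r. diagram_iso q c}"
      using parts(1) by auto
    moreover have "finite (components p)" "finite (components ?r)"
      using finite_components[OF p] finite_components[OF p']
      by (simp_all add: components_relabel[OF inj])
    ultimately show ?thesis
      unfolding component_count_def using parts(2)
      by (simp add: card_Un_disjoint disjoint_iff)
  qed
  ultimately show ?thesis by (simp add: component_count_relabel[OF inj])
qed

text \<open>An irreducible diagram is its own only component, so each list entry contributes 1 or 0
  according to its orbit.\<close>

lemma component_count_juxtapose_list:
  assumes q: "q \<in> partitions l" and "\<And>p. p \<in> set ps \<Longrightarrow> irreducible_diagram p"
  shows "component_count q (juxtapose_list ps) = count (mset (map orb ps)) (orb q)"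
  using assms(2)
proof (induction ps)
  case Nil
  then show ?case by (simp add: component_count_def components_empty)
next
  case (Cons p ps)
  obtain k where p: "p \<in> partitions k" using Cons.prems irreducible_partitions by auto
  obtain m where ps: "juxtapose_list ps \<in> partitions m"
    using juxtapose_list_partitions[of ps] Cons.prems irreducible_partitions by auto
  have "components p = {p}"
    using Cons.prems[of p] irreducible_iff_connected[OF p] components_connected by simp
  then have "{c \<in> components p. diagram_iso q c} = (if orb p = orb q then {p} else {})"
    using diagram_iso_iff_orb[OF q p] by auto
  then have "component_count q p = (if orb p = orb q then 1 else 0)"
    by (simp add: component_count_def)
  then show ?case using Cons by (simp add: component_count_juxtapose[OF p ps])
qed

lemma factorization_unique:
  assumes ps: "\<And>p. p \<in> set ps \<Longrightarrow> irreducible_diagram p"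
    and qs: "\<And>p. p \<in> set qs \<Longrightarrow> irreducible_diagram p"
    and eq: "orb (juxtapose_list ps) = orb (juxtapose_list qs)"
  shows "mset (map orb ps) = mset (map orb qs)"
proof (rule multiset_eqI)
  fix P
  obtain k p where p: "p \<in> partitions k" "P = orb p" by (rule orb_cases)
  obtain l where l: "juxtapose_list ps \<in> partitions l"
    using juxtapose_list_partitions[of ps] ps irreducible_partitions by auto
  obtain m where m: "juxtapose_list qs \<in> partitions m"
    using juxtapose_list_partitions[of qs] qs irreducible_partitions by auto
  have "component_count p (juxtapose_list ps) = component_count p (juxtapose_list qs)"
    by (rule component_count_orb[OF l m eq])
  then show "count (mset (map orb ps)) P = count (mset (map orb qs)) P"
    using component_count_juxtapose_list[OF p(1) ps] component_count_juxtapose_list[OF p(1) qs] p(2)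
    by simp
qed

section \<open>Existence of factorisations, by splitting disconnected diagrams\<close>

lemma saturated_ground:
  assumes P: "partition_on (index -` D) p" and d: "saturated p d"
  shows "partition_on (index -` (index ` \<Union>d)) d"
proof (rule partition_onI)
  have dp: "d \<subseteq> p" using d by (simp add: saturated_def)
  \<comment> \<open>With a point, a saturated set also covers the other label of the same index: the
    block containing that label shares this index.\<close>
  show "\<Union>d = index -` (index ` \<Union>d)"
  proof (intro equalityI subsetI)
    fix x assume "x \<in> index -` (index ` \<Union>d)"
    then obtain y X where y: "X \<in> d" "y \<in> X" "index x = index y" by auto
    then have "y \<in> index -` D" using dp P by (auto simp: partition_on_def)
    then have "x \<in> \<Union>p" using P y by (auto simp: partition_on_def)
    then obtain Y where Y: "Y \<in> p" "x \<in> Y" by auto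
    have "index x \<in> index ` X \<inter> index ` Y"
      using y(2) Y(2) by (metis IntI imageI y(3))
    then have "Y \<in> d" using d y Y unfolding saturated_def by blast
    then show "x \<in> \<Union>d" using Y by auto
  qed auto
  show "disjnt X Y" if "X \<in> d" "Y \<in> d" "X \<noteq> Y" for X Y
    using that dp partition_onD2[OF P] unfolding disjoint_def disjnt_def by blast
  show "{} \<notin> d"
    using dp P by (auto simp: partition_on_def)
qed

text \<open>A proper nonempty saturated set and its complement have complementary index sets in
  \<open>{1..k}\<close>. Numbering each of them consecutively gives the two tensor factors; the
  bijections are arbitrary because orbits do not see the numbering.\<close>

lemma disconnected_splits:
  assumes p: "p \<in> partitions k" and con: "\<not> connected_diagram p" and ne: "p \<noteq> {}"
  obtains m n q r where "q \<in> partitions m" "r \<in> partitions n" "m < k" "n < k" "orb p = orb (q \<otimes>\<^sub>P r)"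
proof -
  have P: "partition_on (index -` {1..k}) p" using p by (simp add: partitions_def ground_eq)
  obtain d where d: "saturated p d" "d \<noteq> {}" "d \<noteq> p"
    using con ne unfolding connected_diagram_def by blast
  then have dp: "d \<subseteq> p" by (simp add: saturated_def)
  define e where "e = p - d"
  have e: "saturated p e" "e \<noteq> {}" "p = d \<union> e"
    using saturated_diff[OF d(1)] d dp by (auto simp: e_def)
  define D E where "D = index ` \<Union>d" and "E = index ` \<Union>e"
  have pd: "partition_on (index -` D) d" and pe: "partition_on (index -` E) e"
    unfolding D_def E_def by (rule saturated_ground[OF P d(1)], rule saturated_ground[OF P e(1)])
  have "D \<inter> E = {}"
  proof -
    have False if "X \<in> d" "Y \<in> e" "x \<in> X" "y \<in> Y" "index x = index y" for X Y x y
    proof -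
      have "index x \<in> index ` X \<inter> index ` Y"
        using that(3,4) by (metis IntI imageI that(5))
      then show False using d(1) that unfolding saturated_def e_def by blast
    qed
    then show ?thesis unfolding D_def E_def by (auto simp: disjoint_iff)
  qed
  have "index ` \<Union>p = {1..k}"
  proof -
    have "\<Union>p = index -` {1..k}" using P by (simp add: partition_on_def)
    moreover have "surj (index :: nat label \<Rightarrow> nat)" by (rule surjI[of _ Unprimed]) simp
    ultimately show ?thesis by (simp add: surj_image_vimage_eq)
  qed
  then have DE: "D \<union> E = {1..k}" unfolding D_def E_def e(3) by (simp only: image_Un Union_Un_distrib)
  then have fin: "finite D" "finite E" by (metis finite_Un finite_atLeastAtMost)+
  define m n where "m = card D" and "n = card E"
  have "m + n = k"
    using card_Un_disjoint[OF fin \<open>D \<inter> E = {}\<close>] by (simp add: DE m_def n_def)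
  obtain h where h: "bij_betw h D {1..m}"
    using ex_bij_betw_finite_nat[OF fin(1)] by (metis bij_betw_iff_card fin(1) finite_atLeastAtMost card_atLeastAtMost diff_Suc_1 m_def)
  obtain h' where h': "bij_betw h' E {1..n}"
    by (metis bij_betw_iff_card fin(2) finite_atLeastAtMost card_atLeastAtMost diff_Suc_1 n_def)
  let ?q = "relabel h d" and ?r = "relabel h' e"
  have q: "?q \<in> partitions m"
    using partition_on_relabel[OF pd, of h] h by (simp add: partitions_def ground_eq bij_betw_def)
  have r: "?r \<in> partitions n"
    using partition_on_relabel[OF pe, of h'] h' by (simp add: partitions_def ground_eq bij_betw_def)
  \<comment> \<open>Numbers the indices in \<open>D\<close> first and those in \<open>E\<close>
    after them, so that \<open>p\<close> becomes the juxtaposition of the two pieces.\<close>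
  define f where "f i = (if i \<in> D then h i else m + h' i)" for i
  have cong: "relabel f c = relabel g c" if "\<And>i. i \<in> index ` \<Union>c \<Longrightarrow> f i = g i" for c g
  proof -
    have "map_label f x = map_label g x" if "x \<in> \<Union>c" for x
      using \<open>\<And>i. i \<in> index ` \<Union>c \<Longrightarrow> f i = g i\<close>[OF imageI[OF that]] by (cases x) simp_all
    then show ?thesis unfolding relabel_def by (intro image_cong refl) auto
  qed
  have "relabel f d = ?q"
    by (rule cong) (simp add: f_def D_def)
  moreover have "relabel f e = relabel ((+) m \<circ> h') e"
  proof (rule cong)
    fix i assume "i \<in> index ` \<Union>e"
    then have "i \<notin> D" using \<open>D \<inter> E = {}\<close> by (auto simp: E_def)
    then show "f i = ((+) m \<circ> h') i" by (simp add: f_def)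
  qed
  ultimately have "relabel f p = ?q \<otimes>\<^sub>P ?r"
    by (simp add: juxtapose_def deg_eq[OF q] e(3) relabel_Un relabel_comp)
  moreover have "?q \<otimes>\<^sub>P ?r \<in> partitions k"
    using juxtapose_partitions[OF q r] \<open>m + n = k\<close> by simp
  ultimately have "orb p = orb (?q \<otimes>\<^sub>P ?r)"
    using orb_relabel_eq[OF p, of f] by simp
  \<comment> \<open>A nonempty diagram has positive degree; both degrees then lie strictly below
    \<open>k\<close>, which drives the later induction.\<close>
  moreover have "m \<noteq> 0" "n \<noteq> 0"
    using d(2) e(2) partitions_0 q r by (auto simp: relabel_def)
  ultimately show ?thesis
    using that[OF q r] \<open>m + n = k\<close> by simp
qed

text \<open>Stated with \<open>sum_list\<close> so that two factorisations are combined by appending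
  the lists.\<close>

lemma factorization_exists_partitions:
  "p \<in> partitions k \<Longrightarrow>
    \<exists>ps. (\<forall>p\<in>set ps. irreducible_diagram p) \<and> orb p = sum_list (map orb ps)"
proof (induction k arbitrary: p rule: less_induct)
  case (less k)
  consider "p = {}" | "connected_diagram p" | "p \<noteq> {}" "\<not> connected_diagram p" by blast
  then show ?case
  proof cases
    case 1
    then show ?thesis by (intro exI[of _ "[]"]) (simp add: orb_empty)
  next
    case 2
    then show ?thesis
      using irreducible_iff_connected[OF less.prems] by (intro exI[of _ "[p]"]) simp
  next
    case 3
    obtain m n q r where qr: "q \<in> partitions m" "r \<in> partitions n" "m < k" "n < k"
      "orb p = orb (q \<otimes>\<^sub>P r)"
      by (rule disconnected_splits[OF less.prems 3(2,1)])
    obtain ps where ps: "\<forall>p\<in>set ps. irreducible_diagram p" "orb q = sum_list (map orb ps)"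
      using less.IH[OF qr(3) qr(1)] by blast
    obtain rs where rs: "\<forall>p\<in>set rs. irreducible_diagram p" "orb r = sum_list (map orb rs)"
      using less.IH[OF qr(4) qr(2)] by blast
    show ?thesis
      using ps rs qr by (intro exI[of _ "ps @ rs"]) (auto simp: orb_juxtapose)
  qed
qed

lemma factorization_exists:
  "\<exists>ps. (\<forall>p\<in>set ps. irreducible_diagram p) \<and> P = orb (juxtapose_list ps)"
proof -
  obtain k p where "p \<in> partitions k" "P = orb p" by (rule orb_cases)
  then obtain ps where "\<forall>p\<in>set ps. irreducible_diagram p" "P = sum_list (map orb ps)"
    using factorization_exists_partitions by blast
  then show ?thesis
    using orb_juxtapose_list irreducible_partitions by (metis (no_types, lifting))
qed

text \<open>The chosen factorisation does not matter, by
  \<open>factorization_unique\<close>.\<close>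

definition orbit_factors :: "diagram_orbit \<Rightarrow> diagram_orbit multiset"
  where "orbit_factors P = mset (map orb
    (SOME ps. (\<forall>p\<in>set ps. irreducible_diagram p) \<and> P = orb (juxtapose_list ps)))"

lemma orbit_factors_orb:
  assumes "\<And>p. p \<in> set ps \<Longrightarrow> irreducible_diagram p"
  shows "orbit_factors (orb (juxtapose_list ps)) = mset (map orb ps)"
proof -
  define qs where "qs = (SOME qs. (\<forall>p\<in>set qs. irreducible_diagram p) \<and>
      orb (juxtapose_list ps) = orb (juxtapose_list qs))"
  have "(\<forall>p\<in>set qs. irreducible_diagram p) \<and> orb (juxtapose_list ps) = orb (juxtapose_list qs)"
    unfolding qs_def by (rule someI_ex[OF factorization_exists])
  then show ?thesis
    unfolding orbit_factors_def qs_def[symmetric]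
    using factorization_unique[of qs ps] assms by simp
qed

lemma orbit_factors_irreducible:
  "irreducible_diagram p \<Longrightarrow> orbit_factors (orb p) = {#orb p#}"
  using orbit_factors_orb[of "[p]"] by (simp add: juxtapose_empty_right)


section \<open>The Hopf algebra of orbits\<close>

lemma orb_juxtapose_irreducible:
  "(\<And>p. p \<in> set ps \<Longrightarrow> irreducible_diagram p) \<Longrightarrow> orb (juxtapose_list ps) = sum_list (map orb ps)"
  by (rule orb_juxtapose_list) (simp add: irreducible_partitions)

interpretation orbit: graded_free_monoid orbit_factors orbit_deg
proof
  show "orbit_factors 0 = {#}"
    using orbit_factors_orb[of "[]"] by (simp add: orb_empty)
  show "orbit_deg (P + Q) = orbit_deg P + orbit_deg Q" for P Q
    by (rule orbit_deg_add)
  show "orbit_deg P = 0 \<Longrightarrow> P = 0" for P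
    by (rule orbit_deg_eq_0)
  show "orbit_factors (P + Q) = orbit_factors P + orbit_factors Q" for P Q
  proof -
    obtain ps where ps: "\<forall>p\<in>set ps. irreducible_diagram p" "P = orb (juxtapose_list ps)"
      using factorization_exists by blast
    obtain qs where qs: "\<forall>p\<in>set qs. irreducible_diagram p" "Q = orb (juxtapose_list qs)"
      using factorization_exists by blast
    have "P + Q = orb (juxtapose_list (ps @ qs))"
      using ps qs by (subst orb_juxtapose_irreducible) (auto simp: orb_juxtapose_irreducible)
    moreover have "orbit_factors (orb (juxtapose_list (ps @ qs))) = mset (map orb (ps @ qs))"
      using ps(1) qs(1) by (intro orbit_factors_orb) auto
    ultimately show ?thesis
      using ps qs by (simp add: orbit_factors_orb)
  qed
  fix P
  obtain ps where ps: "\<forall>p\<in>set ps. irreducible_diagram p" "P = orb (juxtapose_list ps)"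
    using factorization_exists by blast
  then have f: "orbit_factors P = mset (map orb ps)" by (simp add: orbit_factors_orb)
  show "sum_mset (orbit_factors P) = P"
    unfolding f sum_mset_sum_list using ps by (simp add: orb_juxtapose_irreducible)
  show "orbit_factors g = {#g#}" if "g \<in># orbit_factors P" for g
    using that ps(1) by (auto simp: f orbit_factors_irreducible)
qed

lemma sum_list_nths: "sum_list (nths xs I) = (\<Sum>i\<in>{..<length xs} \<inter> I. xs ! i)"
  for xs :: "'a::comm_monoid_add list"
\<comment> \<open>Growing the list at its end leaves earlier positions unchanged, so
  \<open>I\<close> never has to be shifted.\<close>
proof (induction xs rule: rev_induct)
  case (snoc x xs)
  have "{..<length (xs @ [x])} \<inter> I =
      ({..<length xs} \<inter> I) \<union> (if length xs \<in> I then {length xs} else {})"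
    by (auto simp: less_Suc_eq)
  moreover have "(\<Sum>i\<in>{..<length xs} \<inter> I. (xs @ [x]) ! i) = (\<Sum>i\<in>{..<length xs} \<inter> I. xs ! i)"
    by (rule sum.cong) (auto simp: nth_append)
  ultimately show ?case using snoc by (simp add: nths_append add.commute)
qed simp

lemma basis_sum:
  assumes "finite I"
  shows "basis (\<Sum>i\<in>I. f i) = (\<Prod>i\<in>I. basis (f i))"
  using assms by induction (simp_all add: basis_0 basis_add)

lemma comult_juxtapose_list:
  assumes "\<And>p. p \<in> set ps \<Longrightarrow> irreducible_diagram p"
  shows "orbit.comult (basis (orb (juxtapose_list ps))) =
    (\<Sum>I\<in>Pow {..<length ps}.
      tensor (basis (orb (juxtapose_list (nths ps I))))
             (basis (orb (juxtapose_list (nths ps ({..<length ps} - I))))))"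
proof -
  let ?n = "length ps"
  have nths: "orb (juxtapose_list (nths ps I)) = (\<Sum>i\<in>I. orb (ps ! i))" if "I \<subseteq> {..<?n}" for I
  proof -
    have "orb (juxtapose_list (nths ps I)) = sum_list (nths (map orb ps) I)"
      using assms set_nths_subset[of ps I]
      by (subst orb_juxtapose_irreducible) (auto simp: nths_map)
    also have "\<dots> = (\<Sum>i\<in>I. orb (ps ! i))"
      unfolding sum_list_nths using that by (intro sum.cong) auto
    finally show ?thesis .
  qed
  have "orbit.comult (basis (orb (juxtapose_list ps))) =
      (\<Prod>i<?n. basis (orb (ps ! i), 0) + basis (0, orb (ps ! i)))"
  proof -
    have "\<And>g. g \<in> set (map orb ps) \<Longrightarrow> orbit_factors g = {#g#}"
      using assms by (auto simp: orbit_factors_irreducible)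
    then have "orbit.comult (basis (sum_list (map orb ps))) = (\<Prod>i<length (map orb ps).
        basis (map orb ps ! i, 0) + basis (0, map orb ps ! i))"
      by (rule orbit.comult_sum_list)
    then show ?thesis
      by (simp add: orb_juxtapose_irreducible assms)
  qed
  \<comment> \<open>Here \<open>I\<close> records the positions at which the left summand of the
    factor is chosen.\<close>
  also have "\<dots> = (\<Sum>I\<in>Pow {..<?n}. (\<Prod>i\<in>I. basis (orb (ps ! i), 0)) *
      (\<Prod>i\<in>{..<?n} - I. basis (0, orb (ps ! i))))"
    by (rule prod_add) simp
  also have "\<dots> = (\<Sum>I\<in>Pow {..<?n}. tensor (basis (orb (juxtapose_list (nths ps I))))
             (basis (orb (juxtapose_list (nths ps ({..<?n} - I))))))"
  proof (rule sum.cong)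
    fix I assume "I \<in> Pow {..<?n}"
    then have I: "I \<subseteq> {..<?n}" "finite I" by (auto intro: finite_subset)
    show "(\<Prod>i\<in>I. basis (orb (ps ! i), 0)) * (\<Prod>i\<in>{..<?n} - I. basis (0, orb (ps ! i))) =
        tensor (basis (orb (juxtapose_list (nths ps I))))
          (basis (orb (juxtapose_list (nths ps ({..<?n} - I)))))"
      by (simp add: nths I basis_sum[symmetric] basis_add[symmetric] tensor_basis sum_prod)
  qed simp
  finally show ?thesis .
qed

text \<open>\<open>comult_juxtapose_list\<close> supplies a solution valid for all representatives,
  which is the well-definedness of the coproduct. As every orbit has a factorisation, the formula
  fixes a linear solution on the basis, hence everywhere.\<close>

lemma boxplus_coproduct_eq: "boxplus_coproduct = orbit.comult"
  unfolding boxplus_coproduct_def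
proof (rule the_equality)
  show "lin orbit.comult \<and> (\<forall>ps. (\<forall>p\<in>set ps. irreducible_diagram p) \<longrightarrow>
      orbit.comult (basis (orb (juxtapose_list ps))) =
        (\<Sum>I\<in>Pow {..<length ps}.
          tensor (basis (orb (juxtapose_list (nths ps I))))
                 (basis (orb (juxtapose_list (nths ps ({..<length ps} - I)))))))"
    using alg_hom_lin[OF orbit.alg_hom_comult] comult_juxtapose_list by blast
next
  fix D :: "orbit_space \<Rightarrow> orbit_space2"
  assume D: "lin D \<and> (\<forall>ps. (\<forall>p\<in>set ps. irreducible_diagram p) \<longrightarrow>
      D (basis (orb (juxtapose_list ps))) =
        (\<Sum>I\<in>Pow {..<length ps}.
          tensor (basis (orb (juxtapose_list (nths ps I))))
                 (basis (orb (juxtapose_list (nths ps ({..<length ps} - I)))))))"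
  have "D (basis P) = orbit.comult (basis P)" for P
  proof -
    obtain ps where "\<forall>p\<in>set ps. irreducible_diagram p" "P = orb (juxtapose_list ps)"
      using factorization_exists by blast
    then show ?thesis using D by (simp add: comult_juxtapose_list)
  qed
  then show "D = orbit.comult"
    using linear_eqI_basis[of scale D orbit.comult] D alg_hom_lin[OF orbit.alg_hom_comult] by blast
qed

theorem proposition4p1:
  shows "graded_connected_hopf_algebra
    orbit_component orbit_product orbit_unit boxplus_coproduct boxplus_counit"
proof -
  have "orbit_component = homogeneous orbit_deg"
    by (rule ext) (simp add: orbit_component_def orbits_eq span_basis)
  moreover have "orbit_product = mul"
    by (simp add: orbit_product_def mul_def plus_diagram_orbit_def)
  moreover have "orbit_unit = 1"
    by (simp add: orbit_unit_def orb_empty basis_0)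
  moreover have "boxplus_counit = aug"
    by (simp add: boxplus_counit_def aug_def orb_empty)
  ultimately show ?thesis
    using orbit.graded_connected_hopf_algebra by (metis boxplus_coproduct_eq)
qed

end
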